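(* Assume the Continuum Hypothesis. There are sets $X_0,X_1\subseteq\mathbb{R}$, each satisfying $\binom{\mathrm{B}_\Omega}{\mathrm{B}_\Gamma}$, such that the set $X=X_0\cup X_1$ has the following properties: (1) $X$ satisfies $\mathsf{S}_1(\mathrm{B}_\mathrm{T},\mathrm{B}_\Gamma)$ and $\mathsf{S}_1(\mathrm{B},\mathrm{B})$ (and in particular the Gerlits–Nagy property ( * ), i.e., $X$ satisfies both $\mathsf{U}_{\mathrm{fin}}(\mathrm O,\Gamma)$ and $\mathsf S_1(\mathrm O,\mathrm O)$); (2) $X$ does not satisfy $\mathsf{S}_{\mathrm{fin}}(\Omega,\Omega)$; (3) the square $X^2$ does not satisfy $\mathsf{S}_{\mathrm{fin}}(\mathrm O,\mathrm O)$.
   Context: A cover of $X$ is a family $\mathcal U$ with $X=\bigcup\mathcal U$ such that $X$ is not contained in a single member. $\mathrm O(X)$: open covers; $\Omega(X)$: open $\omega$-covers (every finite subset of $X$ lies in some member); $\Gamma(X)$: open $\gamma$-covers (infinite, each point lies in all but finitely many members). A cover $\mathcal U$ is a $\tau$-cover if each point of $X$ lies in infinitely many members of $\mathcal U$ and for all $x,y\in X$, either $x\in U\Rightarrow y\in U$ for all but finitely many $U\in\mathcal U$, or $y\in U\Rightarrow x\in U$ for all but finitely many $U\in\mathcal U$. $\mathrm B(X)$, $\mathrm B_\Omega(X)$, $\mathrm B_\Gamma(X)$, $\mathrm B_\mathrm T(X)$ are the families of countable Borel covers, countable Borel $\omega$-covers, countable Borel $\gamma$-covers, countable Borel $\tau$-covers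 of $X$. For families $\mathscr A,\mathscr B$ of covers: $\binom{\mathscr A}{\mathscr B}$: every member of $\mathscr A(X)$ contains a member of $\mathscr B(X)$; $\mathsf S_1(\mathscr A,\mathscr B)$: for every sequence $(\mathcal U_n)$ in $\mathscr A(X)$ there are $U_n\in\mathcal U_n$ with $\{U_n:n\in\mathbb N\}\in\mathscr B(X)$; $\mathsf S_{\mathrm{fin}}(\mathscr A,\mathscr B)$: for every sequence $(\mathcal U_n)$ in $\mathscr A(X)$ there are finite $\mathcal F_n\subseteq\mathcal U_n$ with $\bigcup_n\mathcal F_n\in\mathscr B(X)$; $\mathsf U_{\mathrm{fin}}(\mathrm O,\Gamma)$ (Hurewicz): for every sequence $(\mathcal U_n)$ of open covers none of which has a finite subcover, there are finite $\mathcal F_n\subseteq\mathcal U_n$ with $\{\bigcup\mathcal F_n:n\in\mathbb N\}\in\Gamma(X)$. The Gerlits–Nagy property ( * ) is (by a known theorem) equivalent to the conjunction of $\mathsf U_{\mathrm{fin}}(\mathrm O,\Gamma)$ and $\mathsf S_1(\mathrm O,\mathrm O)$. *)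

theory Defs
  imports "HOL-Analysis.Analysis"
begin

definition continuum_hypothesis :: bool where
  "continuum_hypothesis \<longleftrightarrow>
     (\<forall>A :: real set. infinite A \<longrightarrow> A \<approx> (UNIV :: nat set) \<or> A \<approx> (UNIV :: real set))"

text \<open>
  A space is given as an abstract topology; a set of reals \<open>X\<close> is the space \<open>top_of_set X\<close>.
  Members of a cover are subsets of the space itself, so open and Borel sets are
  those of the subspace.
\<close>

definition is_cover :: "'a topology \<Rightarrow> 'a set set \<Rightarrow> bool" where
  "is_cover T \<U> \<longleftrightarrow> topspace T = \<Union>\<U> \<and> \<not> (\<exists>U\<in>\<U>. topspace T \<subseteq> U)"

definition is_omega_cover :: "'a topology \<Rightarrow> 'a set set \<Rightarrow> bool" where
  "is_omega_cover T \<U> \<longleftrightarrow>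
     is_cover T \<U> \<and> (\<forall>F. finite F \<and> F \<subseteq> topspace T \<longrightarrow> (\<exists>U\<in>\<U>. F \<subseteq> U))"

definition is_gamma_cover :: "'a topology \<Rightarrow> 'a set set \<Rightarrow> bool" where
  "is_gamma_cover T \<U> \<longleftrightarrow>
     is_cover T \<U> \<and> infinite \<U> \<and> (\<forall>x\<in>topspace T. finite {U\<in>\<U>. x \<notin> U})"

definition is_tau_cover :: "'a topology \<Rightarrow> 'a set set \<Rightarrow> bool" where
  "is_tau_cover T \<U> \<longleftrightarrow>
     is_cover T \<U> \<and>
     (\<forall>x\<in>topspace T. infinite {U\<in>\<U>. x \<in> U}) \<and>
     (\<forall>x\<in>topspace T. \<forall>y\<in>topspace T.
        finite {U\<in>\<U>. \<not> (x \<in> U \<longrightarrow> y \<in> U)} \<or> finite {U\<in>\<U>. \<not> (y \<in> U \<longrightarrow> x \<in> U)})"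

definition borel_sets_of :: "'a topology \<Rightarrow> 'a set set" where
  "borel_sets_of T = sigma_sets (topspace T) {U. openin T U}"

type_synonym 'a cover_class = "'a topology \<Rightarrow> 'a set set set"

definition open_covers :: "'a cover_class" where
  "open_covers T = {\<U>. is_cover T \<U> \<and> (\<forall>U\<in>\<U>. openin T U)}"

definition open_omega_covers :: "'a cover_class" where
  "open_omega_covers T = {\<U>. is_omega_cover T \<U> \<and> (\<forall>U\<in>\<U>. openin T U)}"

definition open_gamma_covers :: "'a cover_class" where
  "open_gamma_covers T = {\<U>. is_gamma_cover T \<U> \<and> (\<forall>U\<in>\<U>. openin T U)}"

definition borel_covers :: "'a cover_class" where
  "borel_covers T = {\<U>. is_cover T \<U> \<and> countable \<U> \<and> \<U> \<subseteq> borel_sets_of T}"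

definition borel_omega_covers :: "'a cover_class" where
  "borel_omega_covers T = {\<U>. is_omega_cover T \<U> \<and> countable \<U> \<and> \<U> \<subseteq> borel_sets_of T}"

definition borel_gamma_covers :: "'a cover_class" where
  "borel_gamma_covers T = {\<U>. is_gamma_cover T \<U> \<and> countable \<U> \<and> \<U> \<subseteq> borel_sets_of T}"

definition borel_tau_covers :: "'a cover_class" where
  "borel_tau_covers T = {\<U>. is_tau_cover T \<U> \<and> countable \<U> \<and> \<U> \<subseteq> borel_sets_of T}"

definition sel_binom :: "'a cover_class \<Rightarrow> 'a cover_class \<Rightarrow> 'a topology \<Rightarrow> bool" where
  "sel_binom \<A> \<B> T \<longleftrightarrow> (\<forall>\<U>\<in>\<A> T. \<exists>\<V>\<in>\<B> T. \<V> \<subseteq> \<U>)"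

definition sel_S1 :: "'a cover_class \<Rightarrow> 'a cover_class \<Rightarrow> 'a topology \<Rightarrow> bool" where
  "sel_S1 \<A> \<B> T \<longleftrightarrow>
     (\<forall>\<U> :: nat \<Rightarrow> 'a set set. (\<forall>n. \<U> n \<in> \<A> T) \<longrightarrow>
        (\<exists>U. (\<forall>n. U n \<in> \<U> n) \<and> {U n |n. True} \<in> \<B> T))"

definition sel_Sfin :: "'a cover_class \<Rightarrow> 'a cover_class \<Rightarrow> 'a topology \<Rightarrow> bool" where
  "sel_Sfin \<A> \<B> T \<longleftrightarrow>
     (\<forall>\<U> :: nat \<Rightarrow> 'a set set. (\<forall>n. \<U> n \<in> \<A> T) \<longrightarrow>
        (\<exists>\<F>. (\<forall>n. finite (\<F> n) \<and> \<F> n \<subseteq> \<U> n) \<and> (\<Union>n. \<F> n) \<in> \<B> T))"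

definition sel_Ufin :: "'a cover_class \<Rightarrow> 'a cover_class \<Rightarrow> 'a topology \<Rightarrow> bool" where
  "sel_Ufin \<A> \<B> T \<longleftrightarrow>
     (\<forall>\<U> :: nat \<Rightarrow> 'a set set.
        (\<forall>n. \<U> n \<in> \<A> T \<and> \<not> (\<exists>\<F>. finite \<F> \<and> \<F> \<subseteq> \<U> n \<and> \<Union>\<F> = topspace T)) \<longrightarrow>
        (\<exists>\<F>. (\<forall>n. finite (\<F> n) \<and> \<F> n \<subseteq> \<U> n) \<and> {\<Union>(\<F> n) |n. True} \<in> \<B> T))"

end

(* The points of X are coded by 0-1 sequences and added in omega_1 steps. Along with them a
   mod-finite increasing chain of partial functions f_a : nat -> bool with infinitely many undefined
   places (Silver conditions) is built; every point added at a stage >= a extends f_a mod finite.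
   Stage a handles one sequence U_n of Borel sets for one of the two sets X_0, X_1. Either finitely many
   new points extending the current condition are contained, together with finitely many old ones,
   in no U_n, and adding them destroys the omega-cover; or a fusion argument based on the Baire
   property of the U_n extends the condition so that some subsequence of U_n is a gamma-cover of
   the old points and of all sequences extending the new condition mod finite. Hence X_0 and X_1
   satisfy (B_Omega choose B_Gamma).
   Since the conditions leave infinitely many places free, X_0 and X_1 can also be given points
   x and y that differ infinitely often, but on a set as sparse as one likes. Placing X_0 and X_1
   in disjoint intervals, X_0 x X_1 becomes a clopen part of X^2 on which counting differences is a
   continuous map onto a dominating family; this refutes the Menger property of X^2. The positive
   properties of X follow from those of X_0 and X_1 because they are additive. *)
theory Submission
  imports Defs
begin

subsection \<open>Category in the Cantor space\<close>

text \<open>The main obstacle is that a later point extends the condition of a stage only up to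
  finitely many places. A member of the gamma-subsequence must therefore contain all modifications
  of a completion y on a long initial segment at once. Hence the covering hypotheses speak about all
  grafts of y (replacements of a prefix), and the finite set of points that destroys a cover is the
  set of all grafts of one y. A second constraint comes from the square: points of X_0 and X_1 have
  to differ infinitely often, so new points must stay away, modulo finite sets, from the countably
  many old ones. The covering hypothesis is thus available only for completions outside a countable
  set, and the fusion has to run through generic completions, which avoid that set. CH enters
  through countability: each stage sees only countably many old points, and a countable chain of
  conditions, for which an upper bound with infinitely many free places can be built by
  diagonalization.\<close>

definition agree :: "nat \<Rightarrow> (nat \<Rightarrow> 'a) \<Rightarrow> (nat \<Rightarrow> 'a) \<Rightarrow> bool" where
  "agree n x y \<longleftrightarrow> (\<forall>i<n. x i = y i)"

definition cantor_open :: "(nat \<Rightarrow> bool) set \<Rightarrow> bool" where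
  "cantor_open S \<longleftrightarrow> (\<forall>x\<in>S. \<exists>n. \<forall>y. agree n x y \<longrightarrow> y \<in> S)"

definition cantor_dense :: "(nat \<Rightarrow> bool) set \<Rightarrow> bool" where
  "cantor_dense S \<longleftrightarrow> (\<forall>x n. \<exists>y\<in>S. agree n x y)"

definition comeager :: "(nat \<Rightarrow> bool) set \<Rightarrow> bool" where
  "comeager S \<longleftrightarrow>
     (\<exists>D :: nat \<Rightarrow> _. (\<forall>i. cantor_open (D i) \<and> cantor_dense (D i)) \<and> (\<Inter>i. D i) \<subseteq> S)"

definition baire_property :: "(nat \<Rightarrow> bool) set \<Rightarrow> bool" where
  "baire_property S \<longleftrightarrow> (\<exists>G. cantor_open G \<and> comeager {x. x \<in> S \<longleftrightarrow> x \<in> G})"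

lemma agree_refl [simp]: "agree n x x"
  by (simp add: agree_def)

lemma agree_sym: "agree n x y \<Longrightarrow> agree n y x"
  by (simp add: agree_def)

lemma agree_trans: "agree n x y \<Longrightarrow> agree n y z \<Longrightarrow> agree n x z"
  by (simp add: agree_def)

lemma agree_mono: "agree n x y \<Longrightarrow> m \<le> n \<Longrightarrow> agree m x y"
  by (simp add: agree_def)

lemma cantor_open_Int: "cantor_open S \<Longrightarrow> cantor_open T \<Longrightarrow> cantor_open (S \<inter> T)"
  unfolding cantor_open_def
proof safe
  fix x assume *: "\<forall>x\<in>S. \<exists>n. \<forall>y. agree n x y \<longrightarrow> y \<in> S" "\<forall>x\<in>T. \<exists>n. \<forall>y. agree n x y \<longrightarrow> y \<in> T"
    and "x \<in> S" "x \<in> T"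
  then obtain n m where "\<forall>y. agree n x y \<longrightarrow> y \<in> S" "\<forall>y. agree m x y \<longrightarrow> y \<in> T"
    by blast
  then show "\<exists>n. \<forall>y. agree n x y \<longrightarrow> y \<in> S \<inter> T"
    by (meson IntI agree_mono max.cobounded1 max.cobounded2)
qed

lemma cantor_open_Union: "(\<And>S. S \<in> \<S> \<Longrightarrow> cantor_open S) \<Longrightarrow> cantor_open (\<Union>\<S>)"
  unfolding cantor_open_def by blast

lemma cantor_dense_Int:
  assumes "cantor_open S" "cantor_dense S" "cantor_dense T"
  shows "cantor_dense (S \<inter> T)"
  unfolding cantor_dense_def
proof (intro allI)
  fix x n
  obtain y where y: "y \<in> S" "agree n x y"
    using assms(2) by (auto simp: cantor_dense_def)
  then obtain m where m: "\<forall>z. agree m y z \<longrightarrow> z \<in> S"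
    using assms(1) by (auto simp: cantor_open_def)
  obtain z where "z \<in> T" "agree (max n m) y z"
    using assms(3) by (auto simp: cantor_dense_def)
  then show "\<exists>y\<in>S \<inter> T. agree n x y"
    using m y by (meson IntI agree_mono agree_trans max.cobounded1 max.cobounded2)
qed

text \<open>For a decreasing sequence, membership in \<open>D i\<close> for all large
  \<open>i\<close> already gives membership in all of them. The fusion argument only controls a
  point from some stage on and relies on this.\<close>

lemma comeager_decseq:
  assumes "comeager S"
  obtains D :: "nat \<Rightarrow> _" where "\<And>i. cantor_open (D i)" "\<And>i. cantor_dense (D i)"
    "decseq D" "(\<Inter>i. D i) \<subseteq> S"
proof -
  obtain D :: "nat \<Rightarrow> _" where D: "\<And>i. cantor_open (D i)" "\<And>i. cantor_dense (D i)" "(\<Inter>i. D i) \<subseteq> S"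
    using assms by (auto simp: comeager_def)
  define E where "E n = (\<Inter>i\<le>n. D i)" for n
  have ESuc: "E (Suc n) = E n \<inter> D (Suc n)" for n
    by (auto simp: E_def le_Suc_eq)
  have E: "cantor_open (E n) \<and> cantor_dense (E n)" for n
  proof (induction n)
    case 0
    then show ?case by (simp add: E_def D)
  next
    case (Suc n)
    then show ?case
      unfolding ESuc by (simp add: cantor_open_Int cantor_dense_Int D)
  qed
  show ?thesis
  proof (rule that[of E])
    show "decseq E"
      unfolding decseq_def E_def by (meson INT_anti_mono atMost_subset_iff order_refl)
    show "(\<Inter>i. E i) \<subseteq> S"
      using D(3) unfolding E_def by blast
  qed (use E in auto)
qed

lemma comeager_mono: "comeager S \<Longrightarrow> S \<subseteq> T \<Longrightarrow> comeager T"
  unfolding comeager_def by (meson order_trans)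

lemma comeager_INT:
  assumes "\<And>n::nat. comeager (S n)"
  shows "comeager (\<Inter>n. S n)"
proof -
  obtain D :: "nat \<Rightarrow> nat \<Rightarrow> _" where D: "\<And>n i. cantor_open (D n i) \<and> cantor_dense (D n i)"
    "\<And>n. (\<Inter>i. D n i) \<subseteq> S n"
    using assms unfolding comeager_def by metis
  have "(\<Inter>k. case_prod D (prod_decode k)) \<subseteq> (\<Inter>n. S n)"
  proof safe
    fix x n assume "x \<in> (\<Inter>k. case_prod D (prod_decode k))"
    then have "x \<in> case_prod D (prod_decode (prod_encode (n, i)))" for i by (rule INT_D) simp
    then show "x \<in> S n" using D(2)[of n] by auto
  qed
  moreover have "\<forall>k. cantor_open (case_prod D (prod_decode k)) \<and> cantor_dense (case_prod D (prod_decode k))"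
    using D(1) by (simp add: split_beta)
  ultimately show ?thesis
    unfolding comeager_def by (intro exI[of _ "\<lambda>k. case_prod D (prod_decode k)"]) simp
qed

lemma comeager_UNIV: "comeager UNIV"
  unfolding comeager_def cantor_open_def cantor_dense_def
  by (intro exI[of _ "\<lambda>_. UNIV"]) (auto intro: agree_refl)

lemma comeager_Int: "comeager S \<Longrightarrow> comeager T \<Longrightarrow> comeager (S \<inter> T)"
  using comeager_INT[of "\<lambda>n. if n = 0 then S else T"]
  by (rule comeager_mono) (auto split: if_splits)

lemma comeager_open_dense: "cantor_open S \<Longrightarrow> cantor_dense S \<Longrightarrow> comeager S"
  unfolding comeager_def by (intro exI[of _ "\<lambda>_. S"]) auto

lemma comeager_Compl_countable:
  assumes "countable C"
  shows "comeager (- C)"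
proof (cases "C = {}")
  case True
  then show ?thesis by (simp add: comeager_UNIV)
next
  case False
  have "comeager (- {z})" for z :: "nat \<Rightarrow> bool"
  proof (rule comeager_open_dense)
    show "cantor_open (- {z})"
      unfolding cantor_open_def
    proof
      fix x assume "x \<in> - {z}"
      then obtain i where "x i \<noteq> z i" by auto
      then have "\<not> agree (Suc i) x z" by (auto simp: agree_def)
      then show "\<exists>n. \<forall>y. agree n x y \<longrightarrow> y \<in> - {z}" by blast
    qed
    show "cantor_dense (- {z})"
      unfolding cantor_dense_def
    proof (intro allI)
      fix x n
      have "(x(n := \<not> z n)) n \<noteq> z n" by simp
      then have "x(n := \<not> z n) \<noteq> z" by metis
      moreover have "agree n x (x(n := \<not> z n))"
        by (simp add: agree_def)
      ultimately show "\<exists>y\<in>- {z}. agree n x y" by blast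
    qed
  qed
  then have "comeager (\<Inter>n. - {from_nat_into C n})"
    by (rule comeager_INT)
  then show ?thesis
    by (rule comeager_mono) (use assms False from_nat_into_surj in fastforce)
qed

lemma agree_limit:
  assumes "\<And>n. agree (N n) (z n) (z (Suc n))" "strict_mono N"
  obtains x where "\<And>n. agree (N n) (z n) x"
proof -
  have *: "agree (N n) (z n) (z m)" if "n \<le> m" for n m
    using that
  proof (induction m rule: dec_induct)
    case (step m)
    then show ?case
      using assms agree_trans agree_mono[OF assms(1)[of m]] by (meson strict_mono_less_eq)
  qed simp
  define x where "x i = z (Suc i) i" for i
  have "agree (N n) (z n) x" for n
    unfolding agree_def
  proof safe
    fix i assume "i < N n"
    have "Suc i \<le> N (Suc i)" using assms(2) by (rule strict_mono_imp_increasing)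
    then show "z n i = x i"
      using * \<open>i < N n\<close> unfolding agree_def x_def
      by (metis le_cases less_eq_Suc_le)
  qed
  then show thesis by (rule that)
qed

text \<open>The Baire category theorem: a nested sequence of cylinders, the next one inside
  \<open>D k\<close>, shrinks to a point of all \<open>D k\<close>. A pair (length, sequence) stands
  for a cylinder.\<close>

theorem cantor_baire:
  assumes "comeager S"
  shows "cantor_dense S"
  unfolding cantor_dense_def
proof (intro allI)
  fix x0 :: "nat \<Rightarrow> bool" and n0
  obtain D :: "nat \<Rightarrow> _" where D: "\<And>i. cantor_open (D i)" "\<And>i. cantor_dense (D i)" "(\<Inter>i. D i) \<subseteq> S"
    using assms by (auto simp: comeager_def)
  have "\<exists>f. \<forall>k. fst (f k) \<ge> n0 \<and> agree n0 x0 (snd (f k)) \<and>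
      (fst (f k) < fst (f (Suc k)) \<and> agree (fst (f k)) (snd (f k)) (snd (f (Suc k)))
       \<and> (\<forall>y. agree (fst (f (Suc k))) (snd (f (Suc k))) y \<longrightarrow> y \<in> D k))"
  proof (intro dependent_nat_choice[where P = "\<lambda>k p. fst p \<ge> n0 \<and> agree n0 x0 (snd p)" and
      Q = "\<lambda>k p q. fst p < fst q \<and> agree (fst p) (snd p) (snd q) \<and>
        (\<forall>y. agree (fst q) (snd q) y \<longrightarrow> y \<in> D k)", simplified conj_assoc])
    show "\<exists>p. n0 \<le> fst p \<and> agree n0 x0 (snd p)"
      by (intro exI[of _ "(n0, x0)"]) auto
  next
    fix p :: "nat \<times> (nat \<Rightarrow> bool)" and k
    assume p: "n0 \<le> fst p \<and> agree n0 x0 (snd p)"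
    obtain y where y: "y \<in> D k" "agree (fst p) (snd p) y"
      using D(2) unfolding cantor_dense_def by blast
    obtain m where m: "\<forall>z. agree m y z \<longrightarrow> z \<in> D k"
      using D(1) y unfolding cantor_open_def by blast
    have "agree n0 x0 y"
      using p y by (meson agree_mono agree_trans)
    then show "\<exists>q. n0 \<le> fst q \<and> agree n0 x0 (snd q) \<and> fst p < fst q \<and>
        agree (fst p) (snd p) (snd q) \<and> (\<forall>z. agree (fst q) (snd q) z \<longrightarrow> z \<in> D k)"
      using p y m agree_mono[of "Suc (max (fst p) m)" y _ m]
      by (intro exI[of _ "(Suc (max (fst p) m), y)"]) auto
  qed
  then obtain f where f: "\<And>k. fst (f k) \<ge> n0 \<and> agree n0 x0 (snd (f k))"
    "\<And>k. fst (f k) < fst (f (Suc k))" "\<And>k. agree (fst (f k)) (snd (f k)) (snd (f (Suc k)))"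
    "\<And>k y. agree (fst (f (Suc k))) (snd (f (Suc k))) y \<Longrightarrow> y \<in> D k"
    by blast
  obtain x where x: "\<And>k. agree (fst (f k)) (snd (f k)) x"
    using agree_limit[of "\<lambda>k. fst (f k)" "\<lambda>k. snd (f k)"] f(2,3) by (metis strict_mono_Suc_iff)
  have "x \<in> S"
    using D(3) f(4) x by blast
  moreover have "agree n0 x0 x"
    using f(1)[of 0] x[of 0] by (meson agree_mono agree_trans)
  ultimately show "\<exists>y\<in>S. agree n0 x0 y" by blast
qed

section \<open>Sets with the Baire property\<close>

lemma baire_property_open: "cantor_open S \<Longrightarrow> baire_property S"
  unfolding baire_property_def using comeager_UNIV by (intro exI[of _ S]) auto

text \<open>\<open>E\<close> is the exterior of \<open>G\<close>. The union of \<open>G\<close> and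
  \<open>E\<close> is open and dense, so on a comeager set the complement of \<open>S\<close>
  coincides with the open set \<open>E\<close>.\<close>

lemma baire_property_Compl:
  assumes "baire_property S"
  shows "baire_property (- S)"
proof -
  obtain G where G: "cantor_open G" "comeager {x. x \<in> S \<longleftrightarrow> x \<in> G}"
    using assms by (auto simp: baire_property_def)
  define E where "E = {x. \<exists>n. \<forall>y. agree n x y \<longrightarrow> y \<notin> G}"
  have E: "cantor_open E"
    unfolding cantor_open_def E_def by (blast intro: agree_trans)
  have "cantor_dense (G \<union> E)"
    unfolding cantor_dense_def E_def by (auto intro: agree_refl)
  moreover have "cantor_open (G \<union> E)"
    using cantor_open_Union[of "{G, E}"] G E by auto
  ultimately have "comeager ((G \<union> E) \<inter> {x. x \<in> S \<longleftrightarrow> x \<in> G})"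
    using G by (simp add: comeager_Int comeager_open_dense)
  then have "comeager {x. x \<in> - S \<longleftrightarrow> x \<in> E}"
    by (rule comeager_mono) (auto simp: E_def)
  then show ?thesis
    unfolding baire_property_def using E by blast
qed

lemma baire_property_UN:
  assumes "\<And>n::nat. baire_property (S n)"
  shows "baire_property (\<Union>n. S n)"
proof -
  obtain G where G: "\<And>n. cantor_open (G n)" "\<And>n. comeager {x. x \<in> S n \<longleftrightarrow> x \<in> G n}"
    using assms unfolding baire_property_def by metis
  have "comeager (\<Inter>n. {x. x \<in> S n \<longleftrightarrow> x \<in> G n})"
    using G by (intro comeager_INT)
  then have "comeager {x. x \<in> (\<Union>n. S n) \<longleftrightarrow> x \<in> (\<Union>n. G n)}"
    by (rule comeager_mono) blast
  moreover have "cantor_open (\<Union>n. G n)"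
    using G by (auto intro: cantor_open_Union)
  ultimately show ?thesis
    unfolding baire_property_def by blast
qed

lemma baire_property_INT_finite:
  assumes "finite I" "\<And>i. i \<in> I \<Longrightarrow> baire_property (S i)"
  shows "baire_property (\<Inter>i\<in>I. S i)"
  using assms
proof (induction I)
  case empty
  have "cantor_open UNIV" by (simp add: cantor_open_def)
  then show ?case by (simp add: baire_property_open)
next
  case (insert i I)
  have "S i \<inter> (\<Inter>i\<in>I. S i) = - (\<Union>n::nat. if n = 0 then - S i else - (\<Inter>i\<in>I. S i))"
    by (auto split: if_splits)
  moreover have "baire_property \<dots>"
  proof (intro baire_property_Compl baire_property_UN)
    show "baire_property (if n = 0 then - S i else - (\<Inter>i\<in>I. S i))" for n :: nat
      using insert baire_property_Compl by (cases "n = 0") (simp_all del: Compl_INT)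
  qed
  ultimately show ?case by simp
qed

lemma baire_property_vimage:
  fixes g :: "(nat \<Rightarrow> bool) \<Rightarrow> 'a::topological_space"
  assumes g: "\<And>V. open V \<Longrightarrow> cantor_open (g -` V)" and "B \<in> sets borel"
  shows "baire_property (g -` B)"
proof -
  have "B \<in> sigma_sets UNIV {S. open S}"
    using assms(2) by (simp add: borel_def)
  then show ?thesis
  proof induction
    case (Basic B)
    then show ?case by (simp add: g baire_property_open)
  next
    case Empty
    show ?case by (simp add: baire_property_open cantor_open_def)
  next
    case (Compl B)
    have "g -` (UNIV - B) = - (g -` B)" by auto
    then show ?case using Compl.IH by (simp add: baire_property_Compl)
  next
    case (Union B)
    then show ?case by (simp add: vimage_UN baire_property_UN)
  qed
qed

section \<open>Fusion of Silver conditions\<close>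

text \<open>Only finitely many prefixes of length \<open>a\<close> exist. They are treated one after
  the other, each lengthening the block found so far, so that the final block on
  \<open>[a, n')\<close> forces membership in \<open>S\<close> whatever stands below
  \<open>a\<close>.\<close>

lemma cantor_dense_uniform:
  assumes "cantor_open S" "cantor_dense S" "a \<le> n"
  obtains n' y' where "n \<le> n'" "agree n y y'" "\<And>w. (\<forall>i. a \<le> i \<and> i < n' \<longrightarrow> w i = y' i) \<Longrightarrow> w \<in> S"
proof -
  define F where "F = (\<lambda>A i. i \<in> A) ` Pow {..<a}"
  have ext: "\<exists>n' y'. n \<le> n' \<and> agree n y y' \<and>
      (\<forall>u\<in>F. \<forall>w. agree a u w \<and> (\<forall>i. a \<le> i \<and> i < n' \<longrightarrow> w i = y' i) \<longrightarrow> w \<in> S)"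
    if "finite F" for F
    using that
  proof (induction F)
    case empty
    then show ?case by (intro exI[of _ n] exI[of _ y]) simp
  next
    case (insert u F)
    then obtain n1 y1 where 1: "n \<le> n1" "agree n y y1"
      "\<And>u w. u \<in> F \<Longrightarrow> agree a u w \<Longrightarrow> (\<forall>i. a \<le> i \<and> i < n1 \<longrightarrow> w i = y1 i) \<Longrightarrow> w \<in> S"
      by blast
    obtain v where v: "v \<in> S" "agree n1 (\<lambda>i. if i < a then u i else y1 i) v"
      using assms(2) unfolding cantor_dense_def by blast
    obtain k where k: "\<And>w. agree k v w \<Longrightarrow> w \<in> S"
      using assms(1) v unfolding cantor_open_def by blast
    \<comment> \<open>The new block keeps \<open>y1\<close> up to \<open>n1\<close>, which preserves
      the work done for earlier prefixes, and copies the tail of \<open>v\<close> beyond it.\<close>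
    define y2 where "y2 i = (if i < n1 then y1 i else v i)" for i
    have "w \<in> S" if w: "agree a u w" "\<forall>i. a \<le> i \<and> i < max n1 k \<longrightarrow> w i = y2 i" for w
    proof (rule k)
      show "agree k v w"
        unfolding agree_def
      proof (intro allI impI)
        fix i assume "i < k"
        show "v i = w i"
        proof (cases "i < a")
          case True
          moreover have "i < n1" using True \<open>a \<le> n\<close> \<open>n \<le> n1\<close> by simp
          ultimately show ?thesis using w(1) v(2) by (auto simp: agree_def)
        next
          case False
          then show ?thesis using w(2) v(2) \<open>i < k\<close> by (auto simp: agree_def y2_def)
        qed
      qed
    qed
    moreover have "w \<in> S" if "u' \<in> F" "agree a u' w" "\<forall>i. a \<le> i \<and> i < max n1 k \<longrightarrow> w i = y2 i" for u' w
      using that by (intro 1(3)[of u']) (auto simp: y2_def)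
    moreover have "agree n y y2"
      using 1(1,2) by (auto simp: agree_def y2_def)
    ultimately show ?case
      using 1(1) by (intro exI[of _ "max n1 k"] exI[of _ y2]) auto
  qed
  have "finite F" by (simp add: F_def)
  from ext[OF this] obtain n' y' where *: "n \<le> n'" "agree n y y'"
    "\<And>u w. u \<in> F \<Longrightarrow> agree a u w \<Longrightarrow> (\<forall>i. a \<le> i \<and> i < n' \<longrightarrow> w i = y' i) \<Longrightarrow> w \<in> S"
    by metis
  show thesis
  proof (rule that[OF *(1,2)])
    fix w assume w: "\<forall>i. a \<le> i \<and> i < n' \<longrightarrow> w i = y' i"
    show "w \<in> S"
    proof (rule *(3)[OF _ _ w])
      show "(\<lambda>i. i \<in> {i. i < a \<and> w i}) \<in> F"
        unfolding F_def by (rule image_eqI[where x = "{i. i < a \<and> w i}"]) auto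
    qed (simp add: agree_def)
  qed
qed

text \<open>By \<open>inv\<close> the set \<open>W a j\<close> ignores the coordinates below
  \<open>a\<close>. Hence it suffices to decide \<open>j\<close> behind a single prefix: a tail that
  forces membership behind this prefix forces it behind every other, whatever values the free places
  take. Decisions are made at generic points, where \<open>C\<close> is avoided and
  \<open>W a j\<close> agrees with an open set.\<close>

theorem silver_fusion:
  fixes W :: "nat \<Rightarrow> nat \<Rightarrow> (nat \<Rightarrow> bool) set"
  assumes bp: "\<And>a j. baire_property (W a j)"
    and inv: "\<And>a j x y. x \<in> W a j \<Longrightarrow> \<forall>i\<ge>a. x i = y i \<Longrightarrow> y \<in> W a j"
    and "countable C" and cov: "\<And>a x. x \<notin> C \<Longrightarrow> \<exists>j. x \<in> W a j"
  shows "\<exists>(f :: nat \<Rightarrow> bool option) (a :: nat \<Rightarrow> nat) j. strict_mono a \<and> infinite {i. f i = None} \<and>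
    (\<forall>m x. (\<forall>i\<ge>a m. f i \<noteq> None \<longrightarrow> f i = Some (x i)) \<longrightarrow> x \<in> W (a m) (j m))"
proof -
  obtain G where G: "\<And>a j. cantor_open (G a j)" "\<And>a j. comeager {x. x \<in> W a j \<longleftrightarrow> x \<in> G a j}"
    using bp unfolding baire_property_def by metis
  \<comment> \<open>The generic points: on \<open>R\<close> every \<open>W a j\<close> may be
    exchanged for the open set \<open>G a j\<close>, and \<open>cov\<close> applies.\<close>
  define R where "R = - C \<inter> (\<Inter>a. \<Inter>j. {x. x \<in> W a j \<longleftrightarrow> x \<in> G a j})"
  have "comeager R"
    unfolding R_def using \<open>countable C\<close> G
    by (intro comeager_Int comeager_INT comeager_Compl_countable) auto
  then obtain D :: "nat \<Rightarrow> _" where D: "\<And>i. cantor_open (D i)" "\<And>i. cantor_dense (D i)"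
    "decseq D" "(\<Inter>i. D i) \<subseteq> R"
    using comeager_decseq by blast
  have RW: "x \<in> W a j \<longleftrightarrow> x \<in> G a j" if "x \<in> R" for x a j
    using that by (auto simp: R_def)
  (* A step from (a, z) to (a', z') fixes the coordinates from a on below a' - 1 and leaves a' - 1 free.
     Its last clause quantifies over all values below a, so that x is generic as soon as it extends a tail of f. *)
  define Q :: "nat \<Rightarrow> nat \<times> (nat \<Rightarrow> bool) \<Rightarrow> nat \<times> (nat \<Rightarrow> bool) \<Rightarrow> bool" where
    "Q = (\<lambda>m (a, z) (a', z'). a < a' \<and> agree a z z' \<and>
       (\<exists>j. \<forall>y. agree (a' - 1) z' y \<longrightarrow> y \<in> G a j) \<and>
       (\<forall>y. (\<forall>i. a \<le> i \<and> i < a' - 1 \<longrightarrow> y i = z' i) \<longrightarrow> y \<in> D m))"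
  have step: "\<exists>q. Q m p q" for m p
  proof -
    obtain a z where p: "p = (a, z)" by force
    obtain y where y: "y \<in> R" "agree a z y"
      using cantor_baire[OF \<open>comeager R\<close>] unfolding cantor_dense_def by blast
    then obtain j where "y \<in> W a j"
      using cov[of y a] by (auto simp: R_def)
    then have "y \<in> G a j" using y RW by blast
    then obtain n where n: "\<And>w. agree n y w \<Longrightarrow> w \<in> G a j"
      using G(1) unfolding cantor_open_def by blast
    obtain n' z' where z': "max a n \<le> n'" "agree (max a n) y z'"
      "\<And>w. (\<forall>i. a \<le> i \<and> i < n' \<longrightarrow> w i = z' i) \<Longrightarrow> w \<in> D m"
      using cantor_dense_uniform[OF D(1) D(2)] max.cobounded1 by metis
    have "w \<in> G a j" if "agree n' z' w" for w
      using that z'(1,2) by (intro n) (meson agree_mono agree_trans max.bounded_iff order_refl)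
    moreover have "agree a z z'"
      using y z' by (meson agree_mono agree_trans max.cobounded1)
    \<comment> \<open>The block \<open>[a, n')\<close> is fixed and the place \<open>n'\<close>
      stays free, hence the new length \<open>Suc n'\<close>.\<close>
    ultimately have "Q m p (Suc n', z')"
      using z' by (auto simp: Q_def p)
    then show ?thesis by blast
  qed
  obtain s where "\<And>m. Q m (s m) (s (Suc m))"
    using dependent_nat_choice[of "\<lambda>_ _. True" Q] step by auto
  moreover define a where "a m = fst (s m)" for m
  moreover define z where "z m = snd (s m)" for m
  ultimately have s: "a m < a (Suc m)" "agree (a m) (z m) (z (Suc m))"
    "\<exists>j. \<forall>y. agree (a (Suc m) - 1) (z (Suc m)) y \<longrightarrow> y \<in> G (a m) j"
    "\<And>y. (\<forall>i. a m \<le> i \<and> i < a (Suc m) - 1 \<longrightarrow> y i = z (Suc m) i) \<Longrightarrow> y \<in> D m" for m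
    by (auto simp: Q_def split_beta)
  have mono: "strict_mono a" by (simp add: strict_mono_Suc_iff s)
  obtain \<sigma> where \<sigma>: "\<And>m. agree (a m) (z m) \<sigma>"
    using agree_limit[of a z] s(2) mono by metis
  obtain j where j: "\<And>m y. agree (a (Suc m) - 1) (z (Suc m)) y \<Longrightarrow> y \<in> G (a m) (j m)"
    using s(3) by metis
  define f where "f i = (if i \<in> range (\<lambda>m. a (Suc m) - 1) then None else Some (\<sigma> i))" for i
  have fz: "f i = Some (z (Suc m) i)" if "a m \<le> i" "i < a (Suc m) - 1" for i m
  proof -
    have "i \<noteq> a (Suc m') - 1" for m'
    proof
      assume i: "i = a (Suc m') - 1"
      have "a m < a (Suc m')" using that i s(1)[of m'] by simp
      then have "m < Suc m'" using mono strict_mono_less by blast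
      moreover have "a (Suc m') < a (Suc m)" using that i by simp
      then have "m' < m" using mono strict_mono_less by blast
      ultimately show False by simp
    qed
    moreover have "\<sigma> i = z (Suc m) i"
      using \<sigma>[of "Suc m"] that by (simp add: agree_def)
    ultimately show ?thesis by (auto simp: f_def)
  qed
  show ?thesis
  proof (intro exI conjI allI impI, rule mono)
    have "strict_mono (\<lambda>m. a (Suc m) - 1)"
      unfolding strict_mono_Suc_iff
    proof
      fix m show "a (Suc m) - 1 < a (Suc (Suc m)) - 1"
        using s(1)[of m] s(1)[of "Suc m"] by linarith
    qed
    then have "infinite (range (\<lambda>m. a (Suc m) - 1))"
      by (simp add: strict_mono_imp_inj_on range_inj_infinite)
    moreover have "range (\<lambda>m. a (Suc m) - 1) \<subseteq> {i. f i = None}"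
      by (auto simp: f_def)
    ultimately show "infinite {i. f i = None}"
      using infinite_super by blast
  next
    fix m x
    assume x: "\<forall>i\<ge>a m. f i \<noteq> None \<longrightarrow> f i = Some (x i)"
    \<comment> \<open>All blocks from stage \<open>m\<close> on are respected by \<open>w\<close>,
      so \<open>w\<close> lies in \<open>D m'\<close> for every \<open>m' \<ge> m\<close>; since
      \<open>D\<close> decreases, \<open>w\<close> lies in all of them.\<close>
    have tail: "w \<in> R" if w: "\<forall>i\<ge>a m. w i = x i" for w
    proof -
      have "w \<in> D m'" if "m' \<ge> m" for m'
      proof (rule s(4), intro allI impI, elim conjE)
        fix i assume i: "a m' \<le> i" "i < a (Suc m') - 1"
        moreover have "a m \<le> a m'" using mono that by (simp add: strict_mono_less_eq)
        ultimately have "a m \<le> i" by simp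
        then have "f i = Some (x i)" "w i = x i" using x w fz[OF i] by blast+
        then show "w i = z (Suc m') i" using fz[OF i] by simp
      qed
      then have "w \<in> D i" for i
        using D(3) by (metis decseq_def in_mono max.cobounded1 max.cobounded2)
      then show "w \<in> R" using D(4) by blast
    qed
    \<comment> \<open>The prefix of \<open>x\<close> is exchanged for the prefix \<open>z m\<close>
      behind which \<open>j m\<close> was decided; \<open>inv\<close> returns from \<open>w\<close>
      to \<open>x\<close>.\<close>
    define w where "w i = (if i < a m then z m i else x i)" for i
    have "agree (a (Suc m) - 1) (z (Suc m)) w"
      unfolding agree_def
    proof (intro allI impI)
      fix i assume i: "i < a (Suc m) - 1"
      show "z (Suc m) i = w i"
      proof (cases "i < a m")
        case True
        then show ?thesis using s(2)[of m] by (simp add: w_def agree_def)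
      next
        case False
        then have "f i = Some (z (Suc m) i)" "f i = Some (x i)" using fz[of m i] i x by auto
        then show ?thesis using False by (simp add: w_def)
      qed
    qed
    then have "w \<in> G (a m) (j m)" by (rule j)
    moreover have "w \<in> R" by (rule tail) (simp add: w_def)
    ultimately have "w \<in> W (a m) (j m)" using RW by blast
    then show "x \<in> W (a m) (j m)"
      by (rule inv) (simp add: w_def)
  qed
qed

subsection \<open>Partial functions modulo finite sets\<close>

text \<open>The larger function is the stronger condition: it may be defined at more places, and it
  keeps the values of the smaller one with finitely many exceptions.\<close>

definition le_star :: "(nat \<Rightarrow> bool option) \<Rightarrow> (nat \<Rightarrow> bool option) \<Rightarrow> bool" (infix "\<preceq>" 50) where
  "f \<preceq> g \<longleftrightarrow> finite {i. f i \<noteq> None \<and> f i \<noteq> g i}"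

abbreviation total :: "(nat \<Rightarrow> bool) \<Rightarrow> nat \<Rightarrow> bool option" where
  "total x \<equiv> \<lambda>i. Some (x i)"

lemma le_star_refl [simp]: "f \<preceq> f"
  by (simp add: le_star_def)

lemma le_star_trans:
  assumes "f \<preceq> g" "g \<preceq> h"
  shows "f \<preceq> h"
proof -
  have "{i. f i \<noteq> None \<and> f i \<noteq> h i} \<subseteq> {i. f i \<noteq> None \<and> f i \<noteq> g i} \<union> {i. g i \<noteq> None \<and> g i \<noteq> h i}"
    by auto
  then show ?thesis
    using assms unfolding le_star_def by (meson finite_UnI finite_subset)
qed

lemma le_star_iff: "f \<preceq> g \<longleftrightarrow> (\<exists>n. \<forall>i\<ge>n. f i \<noteq> None \<longrightarrow> f i = g i)"
proof
  assume "f \<preceq> g"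
  then obtain n where "\<And>i. f i \<noteq> None \<and> f i \<noteq> g i \<Longrightarrow> i < n"
    unfolding le_star_def finite_nat_set_iff_bounded by blast
  then show "\<exists>n. \<forall>i\<ge>n. f i \<noteq> None \<longrightarrow> f i = g i" by (meson leD)
next
  assume "\<exists>n. \<forall>i\<ge>n. f i \<noteq> None \<longrightarrow> f i = g i"
  then obtain n where "\<And>i. n \<le> i \<Longrightarrow> f i \<noteq> None \<Longrightarrow> f i = g i" by blast
  then have "{i. f i \<noteq> None \<and> f i \<noteq> g i} \<subseteq> {..<n}" using not_less by blast
  then show "f \<preceq> g" unfolding le_star_def by (rule finite_subset) simp
qed

text \<open>A diagonal argument: \<open>u n\<close> in \<open>S\<close> bounds the first members of
  an enumeration, and \<open>g\<close> copies \<open>u n\<close> on the block from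
  \<open>N n\<close> to \<open>N (Suc n)\<close>. The blocks begin beyond the finitely many
  disagreements, and each contains a place where \<open>u n\<close> is undefined, so the limit keeps
  infinitely many free places.\<close>

lemma le_star_chain_bound:
  assumes "countable S" and none: "\<And>f. f \<in> S \<Longrightarrow> infinite {i. f i = None}"
    and chain: "\<And>f g. f \<in> S \<Longrightarrow> g \<in> S \<Longrightarrow> f \<preceq> g \<or> g \<preceq> f"
  obtains g where "infinite {i. g i = None}" "\<And>f. f \<in> S \<Longrightarrow> f \<preceq> g"
proof (cases "S = {}")
  case True
  then show ?thesis by (intro that[of "\<lambda>_. None"]) auto
next
  case False
  define s where "s = from_nat_into S"
  have s: "range s = S"
    using False \<open>countable S\<close> by (simp add: s_def range_from_nat_into)
  have "\<exists>u\<in>S. \<forall>k\<le>n. s k \<preceq> u" for n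
  proof (induction n)
    case 0
    then show ?case using s by (intro bexI[of _ "s 0"]) auto
  next
    case (Suc n)
    then obtain u where u: "u \<in> S" "\<forall>k\<le>n. s k \<preceq> u" by blast
    have "s (Suc n) \<in> S" using s by auto
    with chain[OF u(1) this] show ?case
      by (metis le_Suc_eq le_star_refl le_star_trans u)
  qed
  then obtain u where u: "\<And>n. u n \<in> S" "\<And>n k. k \<le> n \<Longrightarrow> s k \<preceq> u n"
    by metis
  have "\<exists>M. \<forall>k\<le>n. \<forall>i\<ge>M. s k i \<noteq> None \<longrightarrow> s k i = u n i" for n
  proof -
    have "\<forall>k. \<exists>M. k \<le> n \<longrightarrow> (\<forall>i\<ge>M. s k i \<noteq> None \<longrightarrow> s k i = u n i)"
      using u(2) unfolding le_star_iff by blast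
    then obtain M where M: "\<And>k i. k \<le> n \<Longrightarrow> i \<ge> M k \<Longrightarrow> s k i \<noteq> None \<Longrightarrow> s k i = u n i"
      by metis
    have "M k \<le> Max (M ` {..n})" if "k \<le> n" for k
      using that by (intro Max_ge) auto
    then show ?thesis using M by (meson order_trans)
  qed
  then obtain M where M: "\<And>n k i. k \<le> n \<Longrightarrow> M n \<le> i \<Longrightarrow> s k i \<noteq> None \<Longrightarrow> s k i = u n i"
    by metis
  \<comment> \<open>\<open>N n\<close> is past the disagreement threshold \<open>M n\<close>, and
    \<open>d n\<close> is the free place reserved in block \<open>n\<close>.\<close>
  have "\<exists>N. \<forall>n. M n \<le> N n \<and> (\<exists>d. N n \<le> d \<and> d < N (Suc n) \<and> u n d = None)"
  proof (rule dependent_nat_choice)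
    fix x n
    have "infinite {i. u n i = None}" using none u by blast
    then obtain d where "d \<ge> x" "u n d = None"
      unfolding infinite_nat_iff_unbounded_le by blast
    then show "\<exists>y. M (Suc n) \<le> y \<and> (\<exists>d\<ge>x. d < y \<and> u n d = None)"
      by (intro exI[of _ "max (M (Suc n)) (Suc d)"]) auto
  qed auto
  then obtain N d where N: "\<And>n. M n \<le> N n" "\<And>n. N n \<le> d n" "\<And>n. d n < N (Suc n)" "\<And>n. u n (d n) = None"
    by metis
  have mono: "strict_mono N"
    unfolding strict_mono_Suc_iff using N(2,3) by (meson le_less_trans)
  define idx where "idx i = (LEAST n. i < N (Suc n))" for i
  have idx: "idx i = n" if "N n \<le> i" "i < N (Suc n)" for i n
    unfolding idx_def
  proof (rule Least_equality)
    fix k assume "i < N (Suc k)"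
    then have "N n < N (Suc k)" using that by simp
    then have "n < Suc k" using mono strict_mono_less by blast
    then show "n \<le> k" by simp
  qed (use that in auto)
  have idx_lt: "i < N (Suc (idx i))" for i
    unfolding idx_def by (rule LeastI[of _ i]) (meson less_le_trans lessI mono strict_mono_imp_increasing)
  have idx_ge: "n \<le> idx i \<and> N (idx i) \<le> i" if "N n \<le> i" for n i
  proof -
    have "N n < N (Suc (idx i))" using that idx_lt by (rule le_less_trans)
    then have 1: "n \<le> idx i" using mono strict_mono_less less_Suc_eq_le by blast
    have "N (idx i) \<le> i"
    proof (cases "idx i")
      case 0
      then show ?thesis using 1 that by simp
    next
      case (Suc k)
      then have "\<not> i < N (Suc k)"
        unfolding idx_def using not_less_Least by (metis lessI)
      then show ?thesis using Suc by simp
    qed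
    with 1 show ?thesis by simp
  qed
  define g where "g i = u (idx i) i" for i
  show thesis
  proof (rule that[of g])
    have "g (d n) = None" for n
      using idx[of n "d n"] N by (simp add: g_def)
    moreover have "n \<le> d n" for n
      using N(2) mono strict_mono_imp_increasing order_trans by blast
    ultimately show "infinite {i. g i = None}"
      unfolding infinite_nat_iff_unbounded_le by blast
  next
    fix f assume "f \<in> S"
    then obtain k where k: "f = s k" using s by blast
    have "s k i = g i" if "i \<ge> N k" "s k i \<noteq> None" for i
      using idx_ge[OF that(1)] M[of k "idx i" i] N(1)[of "idx i"] that by (simp add: g_def)
    then show "f \<preceq> g" unfolding le_star_iff k by blast
  qed
qed

subsection \<open>Enumeration of sequences of Borel sets by reals\<close>

text \<open>Codes give an upper bound for the number of Borel sets: a code is a well-founded tree,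
  hence determined by a function on finite paths, hence by a real.\<close>

datatype borel_code = CBasic nat | CCompl borel_code | CUnion "nat \<Rightarrow> borel_code"

primrec borel_decode :: "(nat \<Rightarrow> 'a set) \<Rightarrow> borel_code \<Rightarrow> 'a set" where
  "borel_decode B (CBasic n) = B n"
| "borel_decode B (CCompl c) = - borel_decode B c"
| "borel_decode B (CUnion c) = (\<Union>n. borel_decode B (c n))"

lemma borel_decode_surj:
  obtains B :: "nat \<Rightarrow> 'a::second_countable_topology set" where "sets borel \<subseteq> range (borel_decode B)"
proof -
  obtain \<B> :: "'a set set" where \<B>: "countable \<B>" "topological_basis \<B>"
    using ex_countable_basis by blast
  \<comment> \<open>Index 0 is reserved for the empty set, which settles the \<open>Empty\<close>
    case of the induction; the basis is shifted by one.\<close>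
  define B where "B n = (if n = 0 then {} else from_nat_into \<B> (n - 1))" for n
  have sub: "A \<in> range (borel_decode B)" if "A \<in> sigma_sets UNIV \<B>" for A
    using that
  proof induction
    case (Basic A)
    then obtain n where "from_nat_into \<B> n = A"
      using \<B> from_nat_into_surj by metis
    then have "borel_decode B (CBasic (Suc n)) = A" by (simp add: B_def)
    then show ?case by blast
  next
    case Empty
    have "borel_decode B (CBasic 0) = {}" by (simp add: B_def)
    then show ?case by (metis rangeI)
  next
    case (Compl A)
    then obtain c where "A = borel_decode B c" by blast
    then have "borel_decode B (CCompl c) = UNIV - A" by auto
    then show ?case by (metis rangeI)
  next
    case (Union A)
    then have "\<forall>n. \<exists>c. A n = borel_decode B c" by blast
    then obtain c where "\<And>n. A n = borel_decode B (c n)" by metis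
    then have "borel_decode B (CUnion c) = (\<Union>n. A n)" by simp
    then show ?case by (metis rangeI)
  qed
  have eq: "sets (borel :: 'a measure) = sigma_sets UNIV \<B>"
    unfolding borel_eq_countable_basis[OF \<B>] by (rule sets_measure_of) simp
  show thesis by (rule that[of B]) (auto simp: eq intro: sub)
qed

text \<open>Labels of the tree along finite paths: the root label is 0 for a complement, 1 for a
  union and at least 2 for a basic set, so it reveals the constructor, and the longer paths reveal
  the subtrees. The value 0 at paths leaving the tree is a mere default.\<close>

primrec code_fun :: "borel_code \<Rightarrow> nat list \<Rightarrow> nat" where
  "code_fun (CBasic n) = (\<lambda>xs. if xs = [] then 2 + n else 0)"
| "code_fun (CCompl c) = (\<lambda>xs. case xs of [] \<Rightarrow> 0 | _ # ys \<Rightarrow> code_fun c ys)"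
| "code_fun (CUnion c) = (\<lambda>xs. case xs of [] \<Rightarrow> 1 | n # ys \<Rightarrow> code_fun (c n) ys)"

lemma code_fun_inj: "inj code_fun"
proof (rule injI)
  show "c = d" if "code_fun c = code_fun d" for c d
    using that
  proof (induction c arbitrary: d)
    case (CBasic n)
    then have "code_fun d [] = 2 + n" by (metis code_fun.simps(1))
    then show ?case by (cases d) auto
  next
    case (CCompl c)
    then have 1: "code_fun d [] = 0" by (metis code_fun.simps(2) list.simps(4))
    then obtain e where e: "d = CCompl e" by (cases d) auto
    have "code_fun c ys = code_fun e ys" for ys
      using fun_cong[OF CCompl.prems, of "0 # ys"] e by simp
    then show ?case using CCompl.IH e by auto
  next
    case (CUnion c)
    then have 1: "code_fun d [] = 1" by (metis code_fun.simps(3) list.simps(4))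
    then obtain e where e: "d = CUnion e" by (cases d) auto
    have "code_fun (c n) ys = code_fun (e n) ys" for n ys
      using fun_cong[OF CUnion.prems, of "n # ys"] e by simp
    then have "c n = e n" for n using CUnion.IH by blast
    then show ?case using e by auto
  qed
qed

subsection \<open>Embedding two copies of the Cantor space into the reals\<close>

text \<open>Ternary expansions with digits 0 and 1: the first differing digit outweighs all later
  ones, so the map is injective with quantitative bounds. A copy has its values in an interval of
  length 3/2, so the shift by 2 leaves a gap of at least 1/2 between the two copies.\<close>

definition cantor_embed :: "bool \<Rightarrow> (nat \<Rightarrow> bool) \<Rightarrow> real" where
  "cantor_embed b x = (\<Sum>i. of_bool (x i) * (1/3) ^ i) + (if b then 2 else 0)"

lemma geometric_tail:
  fixes d :: "nat \<Rightarrow> real"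
  assumes "\<And>i. \<bar>d i\<bar> \<le> (1/3) ^ i"
  shows "summable d" "\<bar>\<Sum>i. d (i + n)\<bar> \<le> 3/2 * (1/3) ^ n"
proof -
  show "summable d"
    by (rule summable_comparison_test[of _ "\<lambda>i. (1/3) ^ i"]) (use assms in auto)
  have 1: "norm (d (i + n)) \<le> (1/3) ^ n * (1/3) ^ i" for i
    using assms[of "i + n"] by (simp add: power_add mult.commute)
  have 2: "(\<lambda>i. (1/3) ^ n * (1/3 :: real) ^ i) sums ((1/3) ^ n * (1 / (1 - 1/3)))"
    by (intro sums_mult geometric_sums) simp
  have "norm (\<Sum>i. d (i + n)) \<le> (\<Sum>i. (1/3) ^ n * (1/3) ^ i)"
    by (rule norm_suminf_le[OF _ sums_summable[OF 2]]) (use 1 in auto)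
  also have "\<dots> = 3/2 * (1/3) ^ n"
    using sums_unique[OF 2] by simp
  finally show "\<bar>\<Sum>i. d (i + n)\<bar> \<le> 3/2 * (1/3) ^ n" by simp
qed

lemma cantor_embed_diff:
  assumes "agree n x y"
  shows "cantor_embed b x - cantor_embed b y = (\<Sum>i. (of_bool (x (i + n)) - of_bool (y (i + n))) * (1/3) ^ (i + n))"
proof -
  define d where "d i = (of_bool (x i) - of_bool (y i)) * (1/3 :: real) ^ i" for i
  have s: "summable (\<lambda>i. of_bool (z i) * (1/3 :: real) ^ i)" for z :: "nat \<Rightarrow> bool"
    by (rule geometric_tail(1)) auto
  have "cantor_embed b x - cantor_embed b y = (\<Sum>i. d i)"
    unfolding cantor_embed_def d_def left_diff_distrib by (simp add: suminf_diff[OF s s])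
  also have "\<dots> = (\<Sum>i. d (i + n)) + (\<Sum>i<n. d i)"
  proof (rule suminf_split_initial_segment)
    show "summable d"
      by (rule geometric_tail(1)) (simp add: d_def abs_mult)
  qed
  also have "(\<Sum>i<n. d i) = 0"
    using assms by (intro sum.neutral) (auto simp: agree_def d_def)
  finally show ?thesis by (simp add: d_def)
qed

lemma cantor_embed_dist_le:
  assumes "agree n x y"
  shows "\<bar>cantor_embed b x - cantor_embed b y\<bar> \<le> 3/2 * (1/3) ^ n"
  unfolding cantor_embed_diff[OF assms]
  using geometric_tail(2)[of "\<lambda>i. (of_bool (x i) - of_bool (y i)) * (1/3) ^ i" n]
  by (simp add: abs_mult)

text \<open>The digit at \<open>n\<close> contributes \<open>(1/3) ^ n\<close> and all later digits
  together at most \<open>3/2 * (1/3) ^ Suc n\<close>, which is half of it.\<close>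

lemma cantor_embed_dist_ge:
  assumes "agree n x y" "x n \<noteq> y n"
  shows "\<bar>cantor_embed b x - cantor_embed b y\<bar> \<ge> 1/2 * (1/3) ^ n"
proof -
  define d where "d i = (of_bool (x i) - of_bool (y i)) * (1/3 :: real) ^ i" for i
  have d: "\<bar>d i\<bar> \<le> (1/3) ^ i" for i by (simp add: d_def abs_mult)
  have "cantor_embed b x - cantor_embed b y = (\<Sum>i. d (i + n))"
    using cantor_embed_diff[OF assms(1)] by (simp add: d_def)
  also have "\<dots> = (\<Sum>i. d (Suc i + n)) + d n"
    using suminf_split_head[of "\<lambda>i. d (i + n)"] geometric_tail(1)[OF d] by (simp add: summable_iff_shift)
  finally have "\<bar>cantor_embed b x - cantor_embed b y\<bar> \<ge> \<bar>d n\<bar> - \<bar>\<Sum>i. d (i + Suc n)\<bar>" by simp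
  moreover have "\<bar>d n\<bar> = (1/3) ^ n" using assms(2) by (auto simp: d_def abs_mult)
  moreover have "\<bar>\<Sum>i. d (i + Suc n)\<bar> \<le> 3/2 * (1/3) ^ Suc n"
    by (rule geometric_tail(2)) (rule d)
  ultimately show ?thesis by simp
qed

lemma cantor_embed_range: "(if b then 2 else 0) \<le> cantor_embed b x" "cantor_embed b x \<le> (if b then 2 else 0) + 3/2"
proof -
  have 1: "\<bar>of_bool (x i) * (1/3) ^ i\<bar> \<le> (1/3 :: real) ^ i" for i by simp
  show "(if b then 2 else 0) \<le> cantor_embed b x"
    unfolding cantor_embed_def using geometric_tail(1)[OF 1] by (simp add: suminf_nonneg)
  show "cantor_embed b x \<le> (if b then 2 else 0) + 3/2"
    unfolding cantor_embed_def using geometric_tail(2)[OF 1, of 0] by simp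
qed

text \<open>The radius is at most 1/2, the gap between the copies, so \<open>b = c\<close>; a first
  difference at some \<open>i \<le> n\<close> would already cost
  \<open>1/2 * (1/3) ^ i\<close>.\<close>

lemma cantor_embed_close:
  assumes "\<bar>cantor_embed b x - cantor_embed c y\<bar> < 1/2 * (1/3) ^ n"
  shows "b = c \<and> agree (Suc n) x y"
proof -
  have "(1/3 :: real) ^ n \<le> 1" by (simp add: power_le_one)
  then have bc: "b = c"
    using assms cantor_embed_range[of b x] cantor_embed_range[of c y] by (cases b; cases c) auto
  have "agree (Suc n) x y"
  proof (rule ccontr)
    assume "\<not> agree (Suc n) x y"
    then have ex: "\<exists>i. i \<le> n \<and> x i \<noteq> y i" by (auto simp: agree_def less_Suc_eq_le)
    define i where "i = (LEAST i. i \<le> n \<and> x i \<noteq> y i)"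
    have i: "i \<le> n" "x i \<noteq> y i" using LeastI_ex[OF ex] by (auto simp: i_def)
    have "agree i x y"
      unfolding agree_def
    proof (intro allI impI)
      fix k assume "k < i"
      then show "x k = y k" using not_less_Least[of k] i(1) unfolding i_def by fastforce
    qed
    then have "\<bar>cantor_embed b x - cantor_embed b y\<bar> \<ge> 1/2 * (1/3) ^ i" using i(2) by (rule cantor_embed_dist_ge)
    moreover have "(1/3 :: real) ^ n \<le> (1/3) ^ i" using i(1) by (simp add: power_decreasing)
    ultimately show False using assms unfolding bc by linarith
  qed
  with bc show ?thesis by simp
qed

lemma cantor_embed_inject: "cantor_embed b x = cantor_embed c y \<longleftrightarrow> b = c \<and> x = y"
proof
  assume "cantor_embed b x = cantor_embed c y"
  then have "b = c \<and> agree (Suc n) x y" for n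
    by (intro cantor_embed_close) simp
  then show "b = c \<and> x = y"
    unfolding agree_def by blast
qed simp

text \<open>The assumption on \<open>K\<close> says that it is non-expanding. This is the form in
  which completions of a condition and their grafts depend on the free coordinates.\<close>

lemma cantor_open_embed_vimage:
  assumes "open V" and K: "\<And>n x y. agree n x y \<Longrightarrow> agree n (K x) (K y)"
  shows "cantor_open ((\<lambda>c. cantor_embed b (K c)) -` V)"
  unfolding cantor_open_def
proof
  fix c assume "c \<in> (\<lambda>c. cantor_embed b (K c)) -` V"
  then obtain e where e: "e > 0" "\<And>r. dist r (cantor_embed b (K c)) < e \<Longrightarrow> r \<in> V"
    using assms(1) unfolding open_dist by auto
  obtain n where n: "(1/3 :: real) ^ n < e / 2"
    using real_arch_pow_inv[of "e / 2" "1/3"] e(1) by auto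
  have "cantor_embed b (K y) \<in> V" if "agree n c y" for y
  proof (rule e(2))
    have "\<bar>cantor_embed b (K y) - cantor_embed b (K c)\<bar> \<le> 3/2 * (1/3) ^ n"
      using K[OF agree_sym[OF that]] by (rule cantor_embed_dist_le)
    then show "dist (cantor_embed b (K y)) (cantor_embed b (K c)) < e"
      using n e(1) by (simp add: dist_real_def)
  qed
  then show "\<exists>n. \<forall>y. agree n c y \<longrightarrow> y \<in> (\<lambda>c. cantor_embed b (K c)) -` V" by blast
qed

text \<open>The characteristic function of the graph of \<open>f a\<close> is a 0-1 sequence, so
  \<open>cantor_embed\<close> turns \<open>f\<close> into an injection into the reals, and any left
  inverse is the required surjection.\<close>

lemma real_surj_onto:
  fixes f :: "'a \<Rightarrow> nat \<Rightarrow> nat"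
  assumes "inj f"
  obtains K :: "real \<Rightarrow> 'a" where "surj K"
proof -
  define h where "h a = cantor_embed False (\<lambda>k. f a (fst (prod_decode k)) = snd (prod_decode k))" for a
  have "inj h"
  proof (rule injI)
    fix a b assume "h a = h b"
    then have *: "(f a (fst (prod_decode k)) = snd (prod_decode k)) = (f b (fst (prod_decode k)) = snd (prod_decode k))" for k
      unfolding h_def cantor_embed_inject by meson
    have "f a n = f b n" for n
      using *[of "prod_encode (n, f a n)"] by simp
    then show "a = b" using assms by (simp add: inj_def fun_eq_iff)
  qed
  then show thesis using that inj_imp_surj_inv by blast
qed

text \<open>One code carries a whole task: in \<open>CUnion c\<close> the entry \<open>c 0\<close>
  is a flag for one of the two sets under construction, and the entries \<open>c (Suc n)\<close>
  code the sequence.\<close>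

lemma borel_sequence_enumeration:
  obtains T :: "real \<Rightarrow> bool \<times> (nat \<Rightarrow> 'a::second_countable_topology set)"
  where "\<And>r n. snd (T r) n \<in> sets borel"
    "\<And>b U. (\<And>n. U n \<in> sets borel) \<Longrightarrow> \<exists>r. T r = (b, U)"
proof -
  obtain B :: "nat \<Rightarrow> 'a set" where B: "sets borel \<subseteq> range (borel_decode B)"
    by (rule borel_decode_surj)
  have "inj (\<lambda>c. code_fun c \<circ> list_decode)"
  proof (rule injI)
    fix c d assume *: "code_fun c \<circ> list_decode = code_fun d \<circ> list_decode"
    have "code_fun c xs = code_fun d xs" for xs
      using fun_cong[OF *, of "list_encode xs"] by simp
    then show "c = d" using code_fun_inj by (simp add: inj_def fun_eq_iff)
  qed
  then obtain K :: "real \<Rightarrow> borel_code" where K: "surj K"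
    by (rule real_surj_onto)
  \<comment> \<open>Defaulting to the empty set makes every real a legitimate task, so no case
    distinction is necessary later.\<close>
  define D where "D c = (let A = borel_decode B c in if A \<in> sets borel then A else {})" for c
  define E where "E c = (case c of CUnion c \<Rightarrow> (c 0 = CBasic 0, \<lambda>n. D (c (Suc n))) | _ \<Rightarrow> (False, \<lambda>_. {}))" for c
  have "\<exists>r. E (K r) = (b, U)" if "\<And>n. U n \<in> sets borel" for b and U :: "nat \<Rightarrow> 'a set"
  proof -
    have "\<forall>n. \<exists>c. U n = borel_decode B c" using that B by blast
    then obtain c where c: "\<And>n. U n = borel_decode B (c n)" by metis
    obtain r where "K r = CUnion (\<lambda>n. case n of 0 \<Rightarrow> CBasic (if b then 0 else 1) | Suc n \<Rightarrow> c n)"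
      using K by (metis surj_def)
    then have "E (K r) = (b, U)"
      using that c by (auto simp: E_def D_def Let_def)
    then show ?thesis by blast
  qed
  moreover have "snd (E c) n \<in> sets borel" for c n
    by (auto simp: E_def D_def Let_def split: borel_code.split)
  ultimately show thesis using that[of "\<lambda>r. E (K r)"] by blast
qed

text \<open>In a well-order of minimal type the proper initial segments have smaller cardinality
  than the reals, and CH leaves only finite and countably infinite ones.\<close>

lemma continuum_hypothesis_order:
  assumes continuum_hypothesis
  obtains R :: "real rel" where "wf R" "trans R" "\<And>a b. a \<noteq> b \<Longrightarrow> (a, b) \<in> R \<or> (b, a) \<in> R"
    "\<And>a. countable {b. (b, a) \<in> R}"
proof -
  include cardinal_syntax
  define r where "r = |UNIV :: real set|"
  have r: "Card_order r" "Field r = UNIV" "Well_order r"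
    unfolding r_def by (rule card_of_Card_order Field_card_of card_of_Well_order)+
  have wo: "Linear_order r" "wf (r - Id)"
    using r(3) by (auto simp: well_order_on_def)
  show thesis
  proof (rule that[OF wo(2)])
    show "trans (r - Id)"
      using wo(1) by (intro trans_diff_Id) (auto simp: order_on_defs)
    show "(a, b) \<in> r - Id \<or> (b, a) \<in> r - Id" if "a \<noteq> b" for a b
      using wo(1) that r(2) by (auto simp: order_on_defs total_on_def)
    show "countable {b. (b, a) \<in> r - Id}" for a
    proof -
      have eq: "{b. (b, a) \<in> r - Id} = underS r a" by (auto simp: underS_def)
      have "|underS r a| <o |UNIV :: real set|"
        using card_of_underS[OF r(1)] r(2) by (simp add: r_def)
      then have "\<not> (\<exists>f. bij_betw f (underS r a) (UNIV :: real set))"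
        using card_of_ordIso not_ordLess_ordIso by blast
      then have "\<not> underS r a \<approx> (UNIV :: real set)" by (simp add: eqpoll_def)
      then have "finite (underS r a) \<or> underS r a \<approx> (UNIV :: nat set)"
        using assms unfolding continuum_hypothesis_def by blast
      then show ?thesis
        unfolding eq by (metis countable_finite countable_iff_bij bij_betw_def countableI eqpoll_def)
    qed
  qed
qed

subsection \<open>One step of the transfinite construction\<close>

lemma countable_almost_equal:
  assumes "countable (C :: (nat \<Rightarrow> bool) set)"
  shows "countable {x. \<exists>c\<in>C. finite {i. x i \<noteq> c i}}"
proof (rule countable_subset)
  show "{x. \<exists>c\<in>C. finite {i. x i \<noteq> c i}} \<subseteq> (\<Union>c\<in>C. (\<lambda>A i. (i \<in> A) \<noteq> c i) ` {A. finite A})"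
  proof
    fix x assume "x \<in> {x. \<exists>c\<in>C. finite {i. x i \<noteq> c i}}"
    then obtain c where c: "c \<in> C" "finite {i. x i \<noteq> c i}" by blast
    have "x = (\<lambda>i. (i \<in> {i. x i \<noteq> c i}) \<noteq> c i)" by auto
    then show "x \<in> (\<Union>c\<in>C. (\<lambda>A i. (i \<in> A) \<noteq> c i) ` {A. finite A})"
      using c by blast
  qed
  show "countable (\<Union>c\<in>C. (\<lambda>A i. (i \<in> A) \<noteq> c i) ` {A :: nat set. finite A})"
    using assms countable_Collect_finite by (intro countable_UN countable_image) auto
qed

lemma countable_vimage_inj:
  assumes "inj f" "countable E"
  shows "countable (f -` E)"
proof (rule countable_image_inj_on)
  show "countable (f ` (f -` E))"
    using assms(2) by (rule countable_subset[rotated]) auto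
  show "inj_on f (f -` E)"
    using assms(1) by (rule inj_on_subset) simp
qed

text \<open>\<open>x0\<close> fills the free places of \<open>f\<close> by a sequence
  \<open>b\<close>, and \<open>x1\<close> is \<open>x0\<close> flipped on a sparse set of free
  places \<open>e n > g n\<close>. Both depend injectively on \<open>b\<close>, so only countably
  many \<open>b\<close> lead to a point almost equal to a member of \<open>C\<close>.\<close>

lemma sparse_pair:
  fixes g :: "nat \<Rightarrow> nat"
  assumes inf: "infinite {i. f i = None}" and "countable C"
  obtains x0 x1 :: "nat \<Rightarrow> bool"
  where "\<And>i. f i \<noteq> None \<Longrightarrow> f i = Some (x0 i)" "\<And>i. f i \<noteq> None \<Longrightarrow> f i = Some (x1 i)"
    "infinite {i. x0 i \<noteq> x1 i}" "\<And>n. card {i. i \<le> g n \<and> x0 i \<noteq> x1 i} \<le> n"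
    "\<And>c. c \<in> C \<Longrightarrow> infinite {i. x0 i \<noteq> c i}" "\<And>c. c \<in> C \<Longrightarrow> infinite {i. x1 i \<noteq> c i}"
proof -
  have "\<exists>e. \<forall>n. (f (e n) = None \<and> g n < e n) \<and> e n < e (Suc n)"
  proof (rule dependent_nat_choice)
    show "\<exists>x. f x = None \<and> g 0 < x"
      using inf unfolding infinite_nat_iff_unbounded by auto
    show "\<exists>y. (f y = None \<and> g (Suc n) < y) \<and> x < y" for x n
    proof -
      obtain y where "max (g (Suc n)) x < y" "f y = None"
        using inf unfolding infinite_nat_iff_unbounded by blast
      then show ?thesis by (intro exI[of _ y]) simp
    qed
  qed
  then obtain e where e: "\<And>n. f (e n) = None" "\<And>n. g n < e n" "\<And>n. e n < e (Suc n)"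
    by blast
  have emono: "strict_mono e" using e(3) by (simp add: strict_mono_Suc_iff)
  define d where "d = enumerate {i. f i = None}"
  have d: "strict_mono d" "range d = {i. f i = None}"
    using inf by (simp_all add: d_def strict_mono_enumerate range_enumerate)
  have dinj: "inj d" using d(1) by (rule strict_mono_imp_inj_on)
  define x0 where "x0 b i = (case f i of None \<Rightarrow> b (inv d i) | Some v \<Rightarrow> v)" for b :: "nat \<Rightarrow> bool" and i
  define x1 where "x1 b i = (x0 b i \<noteq> (i \<in> range e))" for b i
  have x0d: "x0 b (d k) = b k" for b k
  proof -
    have "f (d k) = None" using d(2) by blast
    then show ?thesis by (simp add: x0_def inv_f_f[OF dinj])
  qed
  have "inj x0"
    by (rule injI, rule ext) (metis x0d)
  have "inj x1"
  proof (rule injI)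
    fix b c assume "x1 b = x1 c"
    then have "x0 b i = x0 c i" for i unfolding x1_def by meson
    then show "b = c" using \<open>inj x0\<close> by (simp add: inj_def fun_eq_iff)
  qed
  define E where "E = {x. \<exists>c\<in>C. finite {i. x i \<noteq> c i}}"
  have "countable E"
    unfolding E_def using \<open>countable C\<close> by (rule countable_almost_equal)
  then have "countable (x0 -` E \<union> x1 -` E)"
    using \<open>inj x0\<close> \<open>inj x1\<close> by (intro countable_Un countable_vimage_inj)
  then have "cantor_dense (- (x0 -` E \<union> x1 -` E))"
    by (intro cantor_baire comeager_Compl_countable)
  then obtain b where b: "x0 b \<notin> E" "x1 b \<notin> E"
    unfolding cantor_dense_def by blast
  have diff: "{i. x0 b i \<noteq> x1 b i} = range e"
    by (auto simp: x1_def)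
  show thesis
  proof (rule that)
    show "f i = Some (x0 b i)" if "f i \<noteq> None" for i
      using that by (auto simp: x0_def)
    then show "f i = Some (x1 b i)" if "f i \<noteq> None" for i
      using that e(1) unfolding x1_def by fastforce
    show "infinite {i. x0 b i \<noteq> x1 b i}"
      unfolding diff using emono by (simp add: strict_mono_imp_inj_on range_inj_infinite)
    show "card {i. i \<le> g n \<and> x0 b i \<noteq> x1 b i} \<le> n" for n
    proof -
      have "{i. i \<le> g n \<and> x0 b i \<noteq> x1 b i} \<subseteq> e ` {..<n}"
      proof
        fix i assume "i \<in> {i. i \<le> g n \<and> x0 b i \<noteq> x1 b i}"
        then have "i \<le> g n" "i \<in> range e" by (simp_all flip: diff)
        then obtain k where k: "i = e k" "e k \<le> g n" by auto
        \<comment> \<open>At most \<open>n\<close> of the flipped places can lie at or below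
          \<open>g n\<close>, since \<open>e n\<close> is already beyond it.\<close>
        then have "e k < e n" using e(2)[of n] by simp
        then have "k < n" using emono strict_mono_less by blast
        then show "i \<in> e ` {..<n}" using k by blast
      qed
      then have "card {i. i \<le> g n \<and> x0 b i \<noteq> x1 b i} \<le> card (e ` {..<n})"
        by (rule card_mono[rotated]) simp
      also have "\<dots> \<le> n" using card_image_le[of "{..<n}" e] by simp
      finally show ?thesis .
    qed
    show "infinite {i. x0 b i \<noteq> c i}" "infinite {i. x1 b i \<noteq> c i}" if "c \<in> C" for c
      using b that unfolding E_def by blast+
  qed
qed

section \<open>The alternative: a gamma-subsequence or the destruction of a cover\<close>

definition graft :: "nat \<Rightarrow> (nat \<Rightarrow> 'a) \<Rightarrow> (nat \<Rightarrow> 'a) \<Rightarrow> nat \<Rightarrow> 'a" where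
  "graft n s y i = (if i < n then s i else y i)"

lemma finite_graft: "finite {graft n s (y :: nat \<Rightarrow> bool) | s. True}"
proof (rule finite_subset)
  show "{graft n s y | s. True} \<subseteq> (\<lambda>A. graft n (\<lambda>i. i \<in> A) y) ` Pow {..<n}"
  proof safe
    fix s
    have "graft n s y = graft n (\<lambda>i. i \<in> {i. i < n \<and> s i}) y"
      by (rule ext) (simp add: graft_def)
    then show "graft n s y \<in> (\<lambda>A. graft n (\<lambda>i. i \<in> A) y) ` Pow {..<n}"
      by (rule image_eqI) auto
  qed
qed simp

text \<open>\<open>silver_fusion\<close> is applied on the free places of \<open>g\<close>: a
  sequence \<open>c\<close> stands for the completion \<open>h c\<close>, and \<open>W a j\<close>
  collects the \<open>c\<close> for which \<open>U j\<close> contains the first \<open>a\<close> old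
  points and all grafts of \<open>h c\<close> below \<open>e a\<close>. Asking for all grafts pays
  off at the end: a point that follows \<open>f\<close> only from some place on is itself such a
  graft.\<close>

lemma gamma_step:
  fixes g :: "nat \<Rightarrow> bool option" and U :: "nat \<Rightarrow> real set"
  assumes inf: "infinite {i. g i = None}" and "countable X" "countable C"
    and U: "\<And>n. U n \<in> sets borel"
    and cov: "\<And>n F y. finite F \<Longrightarrow> F \<subseteq> X \<Longrightarrow> (\<And>i. g i \<noteq> None \<Longrightarrow> g i = Some (y i)) \<Longrightarrow>
      (\<And>c. c \<in> C \<Longrightarrow> infinite {i. y i \<noteq> c i}) \<Longrightarrow>
      \<exists>j. cantor_embed b ` F \<subseteq> U j \<and> (\<forall>s. cantor_embed b (graft n s y) \<in> U j)"
  obtains f j where "infinite {i. f i = None}" "g \<preceq> f"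
    "\<And>x. x \<in> X \<or> f \<preceq> total x \<Longrightarrow> eventually (\<lambda>m. cantor_embed b x \<in> U (j m)) sequentially"
proof -
  define e where "e = enumerate {i. g i = None}"
  have e: "strict_mono e" "range e = {i. g i = None}"
    using inf by (simp_all add: e_def strict_mono_enumerate range_enumerate)
  have einj: "inj e" using e(1) by (rule strict_mono_imp_inj_on)
  have ege: "k \<le> e k" for k using e(1) by (rule strict_mono_imp_increasing)
  have inv_e: "e (inv e i) = i" if "g i = None" for i
    using that e(2) by (intro f_inv_into_f) auto
  define h where "h c i = (case g i of None \<Rightarrow> c (inv e i) | Some v \<Rightarrow> v)" for c :: "nat \<Rightarrow> bool" and i
  have he: "h c (e k) = c k" for c k
  proof -
    have "g (e k) = None" using e(2) by blast
    then show ?thesis by (simp add: h_def inv_f_f[OF einj])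
  qed
  have hg: "g i = Some (h c i)" if "g i \<noteq> None" for c i
    using that by (auto simp: h_def)
  define Fin where "Fin a = (if X = {} then {} else from_nat_into X ` {..<a})" for a :: nat
  have Fin: "finite (Fin a)" "Fin a \<subseteq> X" for a
    using from_nat_into[of X] by (auto simp: Fin_def)
  have FinX: "\<exists>a0. \<forall>a\<ge>a0. x \<in> Fin a" if "x \<in> X" for x
  proof -
    obtain k where "from_nat_into X k = x"
      using from_nat_into_surj[OF \<open>countable X\<close> \<open>x \<in> X\<close>] by blast
    then have "x \<in> Fin a" if "a \<ge> Suc k" for a
      using that \<open>x \<in> X\<close> by (auto simp: Fin_def)
    then show ?thesis by blast
  qed
  \<comment> \<open>Finitely many representatives of all prefixes, so that \<open>W a j\<close>
    becomes a finite intersection and inherits the Baire property.\<close>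
  define S where "S n = (\<lambda>A (i::nat). i \<in> A) ` Pow {..<n::nat}" for n
  have graft_S: "\<exists>s'\<in>S n. graft n s y = graft n s' y" for n s and y :: "nat \<Rightarrow> bool"
    by (rule bexI[of _ "\<lambda>i. i \<in> {i. i < n \<and> s i}"])
      (auto simp: graft_def S_def intro!: image_eqI[where x = "{i. i < n \<and> s i}"])
  define W where "W a j = (if cantor_embed b ` Fin a \<subseteq> U j then
      \<Inter>s\<in>S (e a). (\<lambda>c. cantor_embed b (graft (e a) s (h c))) -` U j else {})" for a j
  have W: "c \<in> W a j \<longleftrightarrow> cantor_embed b ` Fin a \<subseteq> U j \<and> (\<forall>s. cantor_embed b (graft (e a) s (h c)) \<in> U j)" for c a j
  proof -
    have "(\<forall>s\<in>S (e a). cantor_embed b (graft (e a) s (h c)) \<in> U j) \<longleftrightarrow> (\<forall>s. cantor_embed b (graft (e a) s (h c)) \<in> U j)"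
      using graft_S[of "e a" _ "h c"] by metis
    then show ?thesis by (simp add: W_def)
  qed
  have bp: "baire_property (W a j)" for a j
  proof (cases "cantor_embed b ` Fin a \<subseteq> U j")
    case True
    have "baire_property ((\<lambda>c. cantor_embed b (graft (e a) s (h c))) -` U j)" for s
    proof (rule baire_property_vimage[OF cantor_open_embed_vimage U])
      fix n and x y :: "nat \<Rightarrow> bool"
      assume xy: "agree n x y"
      have "h x i = h y i" if "i < n" for i
      proof (cases "g i")
        case None
        then have "inv e i < n" using ege[of "inv e i"] inv_e[OF None] that by simp
        then show ?thesis using xy None by (simp add: h_def agree_def)
      qed (simp add: h_def)
      then show "agree n (graft (e a) s (h x)) (graft (e a) s (h y))"
        by (simp add: agree_def graft_def)
    qed
    then show ?thesis
      using True by (auto simp: W_def S_def intro: baire_property_INT_finite)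
  next
    case False
    then show ?thesis by (auto simp: W_def cantor_open_def intro: baire_property_open)
  qed
  \<comment> \<open>Coordinates of \<open>c\<close> from \<open>a\<close> on sit at places from
    \<open>e a\<close> on, and everything below \<open>e a\<close> is overwritten by the
    graft.\<close>
  have inv: "y \<in> W a j" if "x \<in> W a j" and xy: "\<forall>i\<ge>a. x i = y i" for a j x y
  proof -
    have "h x i = h y i" if "i \<ge> e a" for i
    proof (cases "g i")
      case None
      then have "e a \<le> e (inv e i)" using inv_e that by simp
      then have "a \<le> inv e i" using e(1) strict_mono_less_eq by blast
      then show ?thesis using xy None by (simp add: h_def)
    qed (simp add: h_def)
    then have "graft (e a) s (h x) = graft (e a) s (h y)" for s
      by (intro ext) (simp add: graft_def)
    then show ?thesis using that(1) by (simp add: W)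
  qed
  define E where "E = {x. \<exists>c\<in>C. finite {i. x i \<noteq> c i}}"
  have "inj h"
    by (rule injI, rule ext) (metis he)
  moreover have "countable E"
    unfolding E_def using \<open>countable C\<close> by (rule countable_almost_equal)
  ultimately have cnt: "countable (h -` E)"
    by (intro countable_vimage_inj)
  have covW: "\<exists>j. c \<in> W a j" if "c \<notin> h -` E" for a c
    unfolding W using that Fin hg by (intro cov) (auto simp: E_def)
  have "\<exists>(f :: nat \<Rightarrow> bool option) (a :: nat \<Rightarrow> nat) j. strict_mono a \<and> infinite {i. f i = None} \<and>
    (\<forall>m x. (\<forall>i\<ge>a m. f i \<noteq> None \<longrightarrow> f i = Some (x i)) \<longrightarrow> x \<in> W (a m) (j m))"
  proof (rule silver_fusion[where C = "h -` E"])
    show "y \<in> W a j" if "x \<in> W a j" "\<forall>i\<ge>a. x i = y i" for a j x y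
      using that by (rule inv)
  qed (use bp cnt covW in auto)
  then obtain f :: "nat \<Rightarrow> bool option" and a j :: "nat \<Rightarrow> nat"
    where f: "strict_mono a" "infinite {i. f i = None}"
      "\<And>m x. (\<forall>i\<ge>a m. f i \<noteq> None \<longrightarrow> f i = Some (x i)) \<Longrightarrow> x \<in> W (a m) (j m)"
    by (elim exE conjE) blast
  define f' where "f' i = (if g i = None then f (inv e i) else g i)" for i
  have f'e: "f' (e k) = f k" for k
  proof -
    have "g (e k) = None" using e(2) by blast
    then show ?thesis by (simp add: f'_def inv_f_f[OF einj])
  qed
  have "a m \<ge> m" for m using f(1) by (rule strict_mono_imp_increasing)
  show thesis
  proof (rule that)
    have "infinite (e ` {i. f i = None})"
      using f(2) einj by (meson finite_imageD inj_on_subset subset_UNIV)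
    moreover have "e ` {i. f i = None} \<subseteq> {i. f' i = None}" using f'e by auto
    ultimately show "infinite {i. f' i = None}" using infinite_super by blast
    show "g \<preceq> f'" by (simp add: le_star_iff f'_def)
  next
    fix x assume "x \<in> X \<or> f' \<preceq> total x"
    then show "eventually (\<lambda>m. cantor_embed b x \<in> U (j m)) sequentially"
    proof
      assume "x \<in> X"
      then obtain a0 where a0: "\<And>a. a \<ge> a0 \<Longrightarrow> x \<in> Fin a" using FinX by blast
      have "cantor_embed b x \<in> U (j m)" if "m \<ge> a0" for m
      proof -
        \<comment> \<open>Any completion of \<open>f\<close> shows that \<open>W (a m) (j m)\<close>
          is nonempty, and this alone puts the old points of \<open>Fin (a m)\<close> into
          \<open>U (j m)\<close>. The unspecified value of \<open>the\<close> at free places is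
          harmless because \<open>f\<close> imposes nothing there.\<close>
        obtain c where "c \<in> W (a m) (j m)"
          using f(3)[of m "\<lambda>i. the (f i)"] by auto
        moreover have "x \<in> Fin (a m)"
          using a0 that \<open>a m \<ge> m\<close> by simp
        ultimately show ?thesis unfolding W by blast
      qed
      then show ?thesis unfolding eventually_sequentially by blast
    next
      assume "f' \<preceq> total x"
      then obtain M where M: "\<And>i. i \<ge> M \<Longrightarrow> f' i \<noteq> None \<Longrightarrow> f' i = Some (x i)"
        unfolding le_star_iff by blast
      have "cantor_embed b x \<in> U (j m)" if "m \<ge> M" for m
      proof -
        have "e (a m) \<ge> M" using that \<open>a m \<ge> m\<close> ege[of "a m"] by simp
        \<comment> \<open>\<open>c\<close> reads off \<open>x\<close> at the free places of
          \<open>g\<close>. Beyond \<open>M\<close> the point \<open>x\<close> follows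
          \<open>g\<close> at the other places, so grafting its own prefix onto \<open>h c\<close>
          restores \<open>x\<close>.\<close>
        define c where "c k = x (e k)" for k
        have "c \<in> W (a m) (j m)"
        proof (rule f(3), intro allI impI)
          fix k assume k: "a m \<le> k" "f k \<noteq> None"
          have "M \<le> e k" using that \<open>a m \<ge> m\<close> ege[of k] k(1) by simp
          then show "f k = Some (c k)" using M[of "e k"] k f'e by (simp add: c_def)
        qed
        then have "cantor_embed b (graft (e (a m)) x (h c)) \<in> U (j m)" by (simp add: W)
        moreover have "graft (e (a m)) x (h c) i = x i" for i
        proof (cases "i < e (a m)")
          case False
          show ?thesis
          proof (cases "g i")
            case None
            then show ?thesis using inv_e[OF None] by (simp add: graft_def h_def c_def)
          next
            case (Some v)
            then have "g i = Some (x i)"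
              using M[of i] False \<open>e (a m) \<ge> M\<close> by (simp add: f'_def)
            then show ?thesis using False by (simp add: graft_def h_def)
          qed
        qed (simp add: graft_def)
        then have "graft (e (a m)) x (h c) = x" by blast
        ultimately show ?thesis by simp
      qed
      then show ?thesis unfolding eventually_sequentially by blast
    qed
  qed
qed

text \<open>If the covering hypothesis of \<open>gamma_step\<close> fails for some \<open>n\<close>,
  \<open>F\<close> and \<open>y\<close>, the finitely many grafts of \<open>y\<close> below
  \<open>n\<close> form \<open>Z\<close>, and \<open>F\<close> together with \<open>Z\<close> lies
  in no \<open>U j\<close>. They extend \<open>g\<close> modulo finite sets, so the condition can
  stay as it is.\<close>

lemma gamma_or_kill_step:
  fixes g :: "nat \<Rightarrow> bool option" and U :: "nat \<Rightarrow> real set"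
  assumes inf: "infinite {i. g i = None}" and X: "countable X" and C: "countable C"
    and U: "\<And>n. U n \<in> sets borel"
  obtains f Z where "infinite {i. f i = None}" "g \<preceq> f" "finite Z"
    "\<And>z. z \<in> Z \<Longrightarrow> f \<preceq> total z" "\<And>z c. z \<in> Z \<Longrightarrow> c \<in> C \<Longrightarrow> infinite {i. z i \<noteq> c i}"
    "(\<exists>j. \<forall>x. x \<in> X \<or> f \<preceq> total x \<longrightarrow> eventually (\<lambda>m. cantor_embed b x \<in> U (j m)) sequentially) \<or>
     (\<exists>F. finite F \<and> F \<subseteq> X \<union> Z \<and> (\<forall>j. \<not> cantor_embed b ` F \<subseteq> U j))"
proof (cases "\<exists>n F y. finite F \<and> F \<subseteq> X \<and> (\<forall>i. g i \<noteq> None \<longrightarrow> g i = Some (y i)) \<and>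
    (\<forall>c\<in>C. infinite {i. y i \<noteq> c i}) \<and>
    (\<forall>j. \<not> (cantor_embed b ` F \<subseteq> U j \<and> (\<forall>s. cantor_embed b (graft n s y) \<in> U j)))")
  case True
  then obtain n F y where F: "finite F" "F \<subseteq> X" and g: "\<And>i. g i \<noteq> None \<Longrightarrow> g i = Some (y i)"
    and y: "\<And>c. c \<in> C \<Longrightarrow> infinite {i. y i \<noteq> c i}"
    and no: "\<And>j. \<not> (cantor_embed b ` F \<subseteq> U j \<and> (\<forall>s. cantor_embed b (graft n s y) \<in> U j))"
    by blast
  define Z where "Z = {graft n s y | s. True}"
  show thesis
  proof (rule that[of g Z])
    show "finite Z" unfolding Z_def by (rule finite_graft)
    show "g \<preceq> total z" if "z \<in> Z" for z
      unfolding le_star_iff using that g by (intro exI[of _ n]) (auto simp: Z_def graft_def)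
    show "infinite {i. z i \<noteq> c i}" if "z \<in> Z" "c \<in> C" for z c
    proof
      assume "finite {i. z i \<noteq> c i}"
      then have "finite ({i. z i \<noteq> c i} \<union> {..<n})" by simp
      moreover have "{i. y i \<noteq> c i} \<subseteq> {i. z i \<noteq> c i} \<union> {..<n}"
        using that(1) by (auto simp: Z_def graft_def)
      ultimately show False using y[OF that(2)] finite_subset by blast
    qed
    have "\<not> cantor_embed b ` (F \<union> Z) \<subseteq> U j" for j
      using no[of j] unfolding Z_def by blast
    moreover have "finite (F \<union> Z)" using F(1) \<open>finite Z\<close> by simp
    ultimately show "(\<exists>j. \<forall>x. x \<in> X \<or> g \<preceq> total x \<longrightarrow> eventually (\<lambda>m. cantor_embed b x \<in> U (j m)) sequentially) \<or>
       (\<exists>F. finite F \<and> F \<subseteq> X \<union> Z \<and> (\<forall>j. \<not> cantor_embed b ` F \<subseteq> U j))"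
      using F(2) by (intro disjI2 exI[of _ "F \<union> Z"]) blast
  qed (use inf in auto)
next
  case False
  show thesis
  proof (rule gamma_step[OF inf X C U])
    show "\<exists>j. cantor_embed b ` F \<subseteq> U j \<and> (\<forall>s. cantor_embed b (graft n s y) \<in> U j)"
      if "finite F" "F \<subseteq> X" "\<And>i. g i \<noteq> None \<Longrightarrow> g i = Some (y i)"
        "\<And>c. c \<in> C \<Longrightarrow> infinite {i. y i \<noteq> c i}" for n F y
    proof (rule ccontr)
      assume "\<not> ?thesis"
      then have "finite F \<and> F \<subseteq> X \<and> (\<forall>i. g i \<noteq> None \<longrightarrow> g i = Some (y i)) \<and>
          (\<forall>c\<in>C. infinite {i. y i \<noteq> c i}) \<and>
          (\<forall>j. \<not> (cantor_embed b ` F \<subseteq> U j \<and> (\<forall>s. cantor_embed b (graft n s y) \<in> U j)))"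
        using that by blast
      then show False using False by blast
    qed
  next
    fix f j
    assume "infinite {i. f i = None}" "g \<preceq> f"
      "\<And>x. x \<in> X \<or> f \<preceq> total x \<Longrightarrow> eventually (\<lambda>m. cantor_embed b x \<in> U (j m)) sequentially"
    then show thesis
      by (intro that[of f "{}"]) auto
  qed
qed

text \<open>Two points of \<open>X False\<close> and \<open>X True\<close> differ infinitely often, but with arbitrarily sparse
  differences; this makes the counting map of \<open>X False \<times> X True\<close> into the Baire space dominating.\<close>

theorem gamma_pair_construction:
  assumes continuum_hypothesis
  shows "\<exists>X :: bool \<Rightarrow> (nat \<Rightarrow> bool) set.
    (\<forall>b U. (\<forall>n. U n \<in> sets borel) \<longrightarrow> (\<forall>F. finite F \<and> F \<subseteq> X b \<longrightarrow> (\<exists>n. cantor_embed b ` F \<subseteq> U n)) \<longrightarrow>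
      (\<exists>j :: nat \<Rightarrow> nat. \<forall>x\<in>X b. eventually (\<lambda>m. cantor_embed b x \<in> U (j m)) sequentially)) \<and>
    (\<forall>x\<in>X False. \<forall>y\<in>X True. infinite {i. x i \<noteq> y i}) \<and>
    (\<forall>g. \<exists>x\<in>X False. \<exists>y\<in>X True. \<forall>n. card {i. i \<le> g n \<and> x i \<noteq> y i} \<le> n)"
proof -
  obtain R :: "real rel" where R: "wf R" "trans R" "\<And>a b. a \<noteq> b \<Longrightarrow> (a, b) \<in> R \<or> (b, a) \<in> R"
    and Rc: "\<And>a. countable {b. (b, a) \<in> R}"
    using continuum_hypothesis_order[OF assms] by blast
  obtain T :: "real \<Rightarrow> bool \<times> (nat \<Rightarrow> real set)" where T: "\<And>r n. snd (T r) n \<in> sets borel"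
    "\<And>b U. (\<And>n. U n \<in> sets borel) \<Longrightarrow> \<exists>r. T r = (b, U)"
    using borel_sequence_enumeration by blast
  have "inj (id :: (nat \<Rightarrow> nat) \<Rightarrow> _)" by simp
  then obtain G :: "real \<Rightarrow> nat \<Rightarrow> nat" where G: "surj G"
    by (rule real_surj_onto)
  define old where "old S a b = (\<Union>c\<in>{c. (c, a) \<in> R}. snd (S c) b)"
    for S :: "real \<Rightarrow> (nat \<Rightarrow> bool option) \<times> (bool \<Rightarrow> (nat \<Rightarrow> bool) set)" and a and b
  \<comment> \<open>The first alternative also speaks about all future points, since these extend
    \<open>f\<close> modulo finite sets; the second one ensures that the sequence never becomes an
    omega-cover of the final set.\<close>
  define task where "task X Y f b U \<longleftrightarrow>
      (\<exists>j :: nat \<Rightarrow> nat. \<forall>x. x \<in> X \<or> f \<preceq> total x \<longrightarrow> eventually (\<lambda>m. cantor_embed b x \<in> U (j m)) sequentially) \<or>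
      (\<exists>F. finite F \<and> F \<subseteq> X \<union> Y \<and> (\<forall>j. \<not> cantor_embed b ` F \<subseteq> U j))"
    for X Y f b and U :: "nat \<Rightarrow> real set"
  \<comment> \<open>A state consists of a condition and of the new points for each of the two sets.
    The requirement on infinitely many differences links each new point with all old and new points
    of the other set; the clause with \<open>G a\<close> supplies the sparse pair for one
    function.\<close>
  define stage where "stage S a s \<longleftrightarrow>
      infinite {i. fst s i = None} \<and>
      (\<forall>c. (c, a) \<in> R \<longrightarrow> fst (S c) \<preceq> fst s) \<and>
      (\<forall>b. countable (snd s b)) \<and>
      (\<forall>b. \<forall>y\<in>snd s b. fst s \<preceq> total y) \<and>
      (\<forall>b. \<forall>y\<in>snd s b. \<forall>x\<in>old S a (\<not> b) \<union> snd s (\<not> b). infinite {i. y i \<noteq> x i}) \<and>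
      (\<exists>x\<in>snd s False. \<exists>y\<in>snd s True. \<forall>n. card {i. i \<le> G a n \<and> x i \<noteq> y i} \<le> n) \<and>
      task (old S a (fst (T a))) (snd s (fst (T a))) (fst s) (fst (T a)) (snd (T a))"
    for S a s
  have "\<exists>S. \<forall>a. stage S a (S a)"
  proof (rule dependent_wf_choice[OF R(1)])
    fix S S' :: "real \<Rightarrow> (nat \<Rightarrow> bool option) \<times> (bool \<Rightarrow> (nat \<Rightarrow> bool) set)" and a s
    assume eq: "\<And>c. (c, a) \<in> R \<Longrightarrow> S c = S' c"
    then have "old S a = old S' a"
      by (simp add: old_def fun_eq_iff)
    then show "stage S a s = stage S' a s"
      using eq by (simp add: stage_def)
  next
    fix a and S :: "real \<Rightarrow> (nat \<Rightarrow> bool option) \<times> (bool \<Rightarrow> (nat \<Rightarrow> bool) set)"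
    assume IH: "\<And>c. (c, a) \<in> R \<Longrightarrow> stage S c (S c)"
    define L where "L = {c. (c, a) \<in> R}"
    have "countable L" using Rc by (simp add: L_def)
    have le: "fst (S c) \<preceq> fst (S d)" if "c \<in> L" "d \<in> L" "(c, d) \<in> R" for c d
      using IH[of d] that by (simp add: L_def stage_def)
    obtain g where g: "infinite {i. g i = None}" "\<And>f. f \<in> (\<lambda>c. fst (S c)) ` L \<Longrightarrow> f \<preceq> g"
    proof (rule le_star_chain_bound[of "(\<lambda>c. fst (S c)) ` L"])
      show "countable ((\<lambda>c. fst (S c)) ` L)" using \<open>countable L\<close> by simp
      show "infinite {i. f i = None}" if "f \<in> (\<lambda>c. fst (S c)) ` L" for f
        using IH that by (auto simp: L_def stage_def)
      show "f \<preceq> h \<or> h \<preceq> f" if "f \<in> (\<lambda>c. fst (S c)) ` L" "h \<in> (\<lambda>c. fst (S c)) ` L" for f h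
      proof -
        from that obtain c d where "f = fst (S c)" "h = fst (S d)" "c \<in> L" "d \<in> L" by blast
        then show ?thesis using le[of c d] le[of d c] R(3)[of c d] by (cases "c = d") auto
      qed
    qed (rule that)
    define b where "b = fst (T a)"
    define C where "C = old S a False \<union> old S a True"
    have oldC: "countable (old S a b')" for b'
      unfolding old_def using \<open>countable L\<close> IH by (intro countable_UN) (auto simp: L_def stage_def)
    then have "countable C" by (simp add: C_def)
    have CI: "x \<in> old S a b' \<Longrightarrow> x \<in> C" for x b'
      by (cases b') (auto simp: C_def)
    obtain f Z where f: "infinite {i. f i = None}" "g \<preceq> f" "finite Z"
      "\<And>z. z \<in> Z \<Longrightarrow> f \<preceq> total z" "\<And>z c. z \<in> Z \<Longrightarrow> c \<in> C \<Longrightarrow> infinite {i. z i \<noteq> c i}"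
      "task (old S a b) Z f b (snd (T a))"
      by (rule gamma_or_kill_step[where U = "snd (T a)" and b = b,
            OF g(1) oldC[of b] \<open>countable C\<close> T(1), folded task_def]) (rule that)
    have "countable (C \<union> Z)" using \<open>countable C\<close> f(3) by (simp add: countable_finite)
    then obtain x0 x1 :: "nat \<Rightarrow> bool"
      where x: "\<And>i. f i \<noteq> None \<Longrightarrow> f i = Some (x0 i)" "\<And>i. f i \<noteq> None \<Longrightarrow> f i = Some (x1 i)"
        "infinite {i. x0 i \<noteq> x1 i}" "\<And>n. card {i. i \<le> G a n \<and> x0 i \<noteq> x1 i} \<le> n"
        "\<And>c. c \<in> C \<union> Z \<Longrightarrow> infinite {i. x0 i \<noteq> c i}" "\<And>c. c \<in> C \<union> Z \<Longrightarrow> infinite {i. x1 i \<noteq> c i}"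
      by (rule sparse_pair[OF f(1), where g = "G a"]) (rule that)
    \<comment> \<open>The destroying points \<open>Z\<close> join the set that the task is about,
      and the sparse pair is split between the two sets.\<close>
    define Y where "Y c = (if c = b then Z else {}) \<union> {if c then x1 else x0}" for c
    have sym: "{i. p i \<noteq> q i} = {i. q i \<noteq> p i}" for p q :: "nat \<Rightarrow> bool" by auto
    have x': "infinite {i. x1 i \<noteq> x0 i}" "\<And>z. z \<in> Z \<Longrightarrow> infinite {i. z i \<noteq> x0 i}"
      "\<And>z. z \<in> Z \<Longrightarrow> infinite {i. z i \<noteq> x1 i}"
      using x(3,5,6) sym by (metis UnI2)+
    have "stage S a (f, Y)"
      unfolding stage_def fst_conv snd_conv
    proof (intro conjI allI impI ballI)
      show "fst (S c) \<preceq> f" if "(c, a) \<in> R" for c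
        using g(2)[of "fst (S c)"] f(2) that le_star_trans by (auto simp: L_def)
      show "countable (Y c)" for c
        using f(3) by (simp add: Y_def countable_finite)
      show "f \<preceq> total y" if "y \<in> Y c" for c y
        using that f(4) x(1,2) by (auto simp: Y_def le_star_iff split: if_splits)
      show "infinite {i. y i \<noteq> z i}" if "y \<in> Y c" "z \<in> old S a (\<not> c) \<union> Y (\<not> c)" for c y z
        using that(2)
      proof
        assume "z \<in> old S a (\<not> c)"
        then have "z \<in> C" by (rule CI)
        then show ?thesis
          using that(1) f(5) x(5,6) by (auto simp: Y_def split: if_splits)
      next
        assume "z \<in> Y (\<not> c)"
        then show ?thesis
          using that(1) x(3) x' x(5,6)[OF UnI2] by (cases c; cases b) (auto simp: Y_def simp del: Collect_neg_eq)
      qed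
      have "x0 \<in> Y False" "x1 \<in> Y True" by (simp_all add: Y_def)
      then show "\<exists>x\<in>Y False. \<exists>y\<in>Y True. \<forall>n. card {i. i \<le> G a n \<and> x i \<noteq> y i} \<le> n"
        using x(4) by blast
      \<comment> \<open>Adding the points of the sparse pair does no harm, since \<open>task\<close>
        is monotone in the set of new points.\<close>
      have "old S a b \<union> Z \<subseteq> old S a b \<union> Y b" by (auto simp: Y_def)
      then have "task (old S a b) (Y b) f b (snd (T a))"
        using f(6) unfolding task_def by (meson order_trans)
      then show "task (old S a (fst (T a))) (Y (fst (T a))) f (fst (T a)) (snd (T a))"
        by (simp only: b_def)
    qed (use f in auto)
    then show "\<exists>s. stage S a s" by blast
  qed
  then obtain S where S: "\<And>a. stage S a (S a)" by blast
  define X where "X b = (\<Union>a. snd (S a) b)" for b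
  have oldX: "old S a b \<subseteq> X b" for a b by (auto simp: old_def X_def)
  show ?thesis
  proof (intro exI[of _ X] conjI allI impI ballI)
    fix b and U :: "nat \<Rightarrow> real set"
    assume U: "\<forall>n. U n \<in> sets borel" and cov: "\<forall>F. finite F \<and> F \<subseteq> X b \<longrightarrow> (\<exists>n. cantor_embed b ` F \<subseteq> U n)"
    obtain a where a: "T a = (b, U)" using T(2)[of U b] U by blast
    have "task (old S a b) (snd (S a) b) (fst (S a)) b U"
      using S[of a] a by (simp add: stage_def)
    moreover
    have "old S a b \<union> snd (S a) b \<subseteq> X b"
      using oldX by (auto simp: X_def)
    \<comment> \<open>The destructive alternative contradicts the covering assumption, so the gamma
      alternative was realized at stage \<open>a\<close>.\<close>
    then have "\<not> (\<exists>F. finite F \<and> F \<subseteq> old S a b \<union> snd (S a) b \<and> (\<forall>j. \<not> cantor_embed b ` F \<subseteq> U j))"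
      using cov by (meson order_trans)
    ultimately obtain j :: "nat \<Rightarrow> nat" where
      j: "\<And>x. x \<in> old S a b \<or> fst (S a) \<preceq> total x \<Longrightarrow> eventually (\<lambda>m. cantor_embed b x \<in> U (j m)) sequentially"
      unfolding task_def by blast
    have "eventually (\<lambda>m. cantor_embed b x \<in> U (j m)) sequentially" if "x \<in> X b" for x
    proof (rule j)
      from that obtain c where c: "x \<in> snd (S c) b" by (auto simp: X_def)
      then have fc: "fst (S c) \<preceq> total x" using S[of c] by (simp add: stage_def)
      \<comment> \<open>Points from before stage \<open>a\<close> are old; points from stage
        \<open>a\<close> or later extend its condition modulo finite sets.\<close>
      consider "(c, a) \<in> R" | "c = a" | "(a, c) \<in> R" using R(3) by blast
      then show "x \<in> old S a b \<or> fst (S a) \<preceq> total x"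
      proof cases
        case 1
        then show ?thesis using c by (auto simp: old_def)
      next
        case 2
        then show ?thesis using fc by simp
      next
        case 3
        then have "fst (S a) \<preceq> fst (S c)" using S[of c] by (simp add: stage_def)
        then show ?thesis using fc le_star_trans by blast
      qed
    qed
    then show "\<exists>j :: nat \<Rightarrow> nat. \<forall>x\<in>X b. eventually (\<lambda>m. cantor_embed b x \<in> U (j m)) sequentially" by blast
  next
    fix x y assume "x \<in> X False" "y \<in> X True"
    then obtain c d where c: "x \<in> snd (S c) False" and d: "y \<in> snd (S d) True" by (auto simp: X_def)
    have stage: "infinite {i. p i \<noteq> q i}" if "p \<in> snd (S c) b" "q \<in> snd (S d) (\<not> b)" "(d, c) \<in> R \<or> d = c"
      for p q b c d
    proof -
      have "q \<in> old S c (\<not> b) \<union> snd (S c) (\<not> b)" using that by (auto simp: old_def)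
      then show ?thesis using S[of c] that(1) by (simp add: stage_def)
    qed
    have sym: "{i. x i \<noteq> y i} = {i. y i \<noteq> x i}" by auto
    consider "(d, c) \<in> R \<or> d = c" | "(c, d) \<in> R" using R(3) by blast
    then show "infinite {i. x i \<noteq> y i}"
    proof cases
      case 1
      then show ?thesis using stage[of x c False y d] c d by simp
    next
      case 2
      then show ?thesis unfolding sym using stage[of y d True x c] c d by simp
    qed
  next
    fix g
    obtain a where "G a = g" using G by (metis surj_def)
    then show "\<exists>x\<in>X False. \<exists>y\<in>X True. \<forall>n. card {i. i \<le> g n \<and> x i \<noteq> y i} \<le> n"
      using S[of a] by (auto simp: stage_def X_def)
  qed
qed

subsection \<open>Selection principles for Borel covers\<close>

text \<open>A sequential form of (B_Omega choose B_Gamma) with Borel sets of the ambient space.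
  Members may contain all of \<open>X\<close> and indices may repeat, which spares the nontriviality
  clauses of covers.\<close>

definition borel_gamma :: "'a::topological_space set \<Rightarrow> bool" where
  "borel_gamma X \<longleftrightarrow> (\<forall>U :: nat \<Rightarrow> 'a set. (\<forall>n. U n \<in> sets borel) \<longrightarrow>
     (\<forall>F. finite F \<and> F \<subseteq> X \<longrightarrow> (\<exists>n. F \<subseteq> U n)) \<longrightarrow>
     (\<exists>j :: nat \<Rightarrow> nat. \<forall>x\<in>X. eventually (\<lambda>m. x \<in> U (j m)) sequentially))"

text \<open>Sending \<open>x\<close> and \<open>n\<close> to the least \<open>m\<close> with
  \<open>x \<in> A n m\<close> gives a Borel map into the Baire space; the condition says that its
  image is bounded modulo finite sets.\<close>

definition borel_bounded :: "'a::topological_space set \<Rightarrow> bool" where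
  "borel_bounded X \<longleftrightarrow> (\<forall>A :: nat \<Rightarrow> nat \<Rightarrow> 'a set. (\<forall>n m. A n m \<in> sets borel) \<longrightarrow>
     (\<forall>n. incseq (A n)) \<longrightarrow> (\<forall>n. X \<subseteq> (\<Union>m. A n m)) \<longrightarrow>
     (\<exists>g. \<forall>x\<in>X. eventually (\<lambda>n. x \<in> A n (g n)) sequentially))"

definition borel_rothberger :: "'a::topological_space set \<Rightarrow> bool" where
  "borel_rothberger X \<longleftrightarrow> (\<forall>V :: nat \<Rightarrow> nat \<Rightarrow> 'a set. (\<forall>n k. V n k \<in> sets borel) \<longrightarrow>
     (\<forall>n. X \<subseteq> (\<Union>k. V n k)) \<longrightarrow> (\<exists>k. X \<subseteq> (\<Union>n. V n (k n))))"

text \<open>An infinite index set is obtained from the sequence \<open>j\<close> by first emptying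
  the finitely many members that contain \<open>X\<close>. Then every member misses a point, and
  eventual membership of that point makes each fibre of \<open>j\<close> finite.\<close>

lemma borel_gamma_infinite:
  fixes U :: "nat \<Rightarrow> 'a::topological_space set"
  assumes X: "borel_gamma X" and U: "\<And>n. U n \<in> sets borel"
    and inf: "\<And>F. finite F \<Longrightarrow> F \<subseteq> X \<Longrightarrow> infinite {n. F \<subseteq> U n}"
  obtains J where "infinite J" "\<And>x. x \<in> X \<Longrightarrow> finite {n\<in>J. x \<notin> U n}"
proof (cases "infinite {n. X \<subseteq> U n}")
  case True
  have "{n \<in> {n. X \<subseteq> U n}. x \<notin> U n} = {}" if "x \<in> X" for x
    using that by blast
  then show thesis using that[OF True] by (metis finite.emptyI)
next
  case False
  define K where "K = {n. X \<subseteq> U n}"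
  have K: "finite K" using False by (simp add: K_def)
  have "X \<noteq> {}" using False by auto
  define U' where "U' n = (if n \<in> K then {} else U n)" for n
  have "\<exists>n. F \<subseteq> U' n" if "finite F" "F \<subseteq> X" for F
  proof -
    have "infinite ({n. F \<subseteq> U n} - K)"
      using inf[OF that] K by simp
    then have "{n. F \<subseteq> U n} - K \<noteq> {}" by (rule infinite_imp_nonempty)
    then obtain n where "n \<in> {n. F \<subseteq> U n} - K" by blast
    then show ?thesis by (intro exI[of _ n]) (simp add: U'_def)
  qed
  moreover have "U' n \<in> sets borel" for n using U by (simp add: U'_def)
  ultimately obtain j :: "nat \<Rightarrow> nat"
    where j: "\<And>x. x \<in> X \<Longrightarrow> eventually (\<lambda>m. x \<in> U' (j m)) sequentially"
    using X unfolding borel_gamma_def by meson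
  have fin: "finite {m. x \<notin> U' (j m)}" if "x \<in> X" for x
    using j[OF that] by (simp add: cofinite_eq_sequentially[symmetric] eventually_cofinite)
  have fibre: "finite {m. j m = n}" for n
  proof -
    obtain x where x: "x \<in> X" "x \<notin> U' n"
      using \<open>X \<noteq> {}\<close> by (cases "n \<in> K") (auto simp: U'_def K_def)
    have "{m. j m = n} \<subseteq> {m. x \<notin> U' (j m)}" using x(2) by auto
    then show ?thesis using fin[OF x(1)] finite_subset by blast
  qed
  show thesis
  proof (rule that)
    show "infinite (range j)"
    proof
      assume "finite (range j)"
      then have "finite (\<Union>n\<in>range j. {m. j m = n})" using fibre by blast
      moreover have "(\<Union>n\<in>range j. {m. j m = n}) = UNIV" by auto
      ultimately show False by simp
    qed
    show "finite {n\<in>range j. x \<notin> U n}" if "x \<in> X" for x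
    proof (rule finite_subset)
      show "{n\<in>range j. x \<notin> U n} \<subseteq> j ` {m. x \<notin> U' (j m)}" by (auto simp: U'_def)
      show "finite (j ` {m. x \<notin> U' (j m)})" using fin[OF that] by simp
    qed
  qed
qed

text \<open>Removing the point \<open>z n\<close> from the members of the \<open>n\<close>-th family forces a \<open>\<gamma>\<close>-subsequence to
  meet infinitely many of the families (the Gerlits--Nagy trick).\<close>

lemma borel_gamma_columns:
  fixes W :: "nat \<Rightarrow> 'b::countable \<Rightarrow> 'a::t1_space set"
  assumes X: "borel_gamma X" and W: "\<And>n s. W n s \<in> sets borel"
    and cov: "\<And>n F. finite F \<Longrightarrow> F \<subseteq> X \<Longrightarrow> \<exists>s. F \<subseteq> W n s"
  obtains N :: "nat set" and s where "infinite N" "\<And>x. x \<in> X \<Longrightarrow> finite {n\<in>N. x \<notin> W n (s n)}"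
proof (cases "finite X")
  case True
  then obtain s where s: "\<And>n. X \<subseteq> W n (s n)" using cov[of X] by (metis order_refl)
  have "{n \<in> UNIV. x \<notin> W n (s n)} = {}" if "x \<in> X" for x
    using s that by blast
  then show thesis using that[OF infinite_UNIV_nat, of s] by (metis finite.emptyI)
next
  case False
  then obtain z :: "nat \<Rightarrow> 'a" where z: "inj z" "range z \<subseteq> X"
    using iffD1[OF infinite_iff_countable_subset] by blast
  define p :: "nat \<Rightarrow> nat \<times> 'b" where "p = from_nat"
  define U where "U i = W (fst (p i)) (snd (p i)) - {z (fst (p i))}" for i
  have U: "U i \<in> sets borel" for i
    unfolding U_def by (rule sets.Diff[OF W borel_closed[OF closed_singleton]])
  \<comment> \<open>Since \<open>z\<close> is injective, \<open>F\<close> contains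
    \<open>z n\<close> for only finitely many \<open>n\<close>; every other family still contributes
    a set containing \<open>F\<close>.\<close>
  have inf: "infinite {i. F \<subseteq> U i}" if F: "finite F" "F \<subseteq> X" for F
  proof -
    obtain s where s: "\<And>n. F \<subseteq> W n (s n)" using cov[OF F] by metis
    have "finite (z -` F)" using F(1) z(1) by (rule finite_vimageI)
    then have "infinite (- (z -` F))" by (simp add: Compl_eq_Diff_UNIV infinite_UNIV_nat)
    moreover have "inj_on (\<lambda>n. to_nat (n, s n)) (- (z -` F))"
      by (rule inj_onI) simp
    ultimately have "infinite ((\<lambda>n. to_nat (n, s n)) ` (- (z -` F)))"
      using finite_imageD by blast
    moreover have "(\<lambda>n. to_nat (n, s n)) ` (- (z -` F)) \<subseteq> {i. F \<subseteq> U i}"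
      using subsetD[OF s] by (auto simp: U_def p_def)
    ultimately show ?thesis using infinite_super by blast
  qed
  obtain J where J: "infinite J" "\<And>x. x \<in> X \<Longrightarrow> finite {i\<in>J. x \<notin> U i}"
    using borel_gamma_infinite[of X U] X U inf by metis
  define N where "N = (\<lambda>i. fst (p i)) ` J"
  have "\<forall>n. \<exists>i. n \<in> N \<longrightarrow> i \<in> J \<and> fst (p i) = n" by (auto simp: N_def)
  then obtain i where i: "\<And>n. n \<in> N \<Longrightarrow> i n \<in> J \<and> fst (p (i n)) = n" by metis
  show thesis
  proof (rule that[of N "\<lambda>n. snd (p (i n))"])
    \<comment> \<open>Every set of the family \<open>n\<close> misses \<open>z n\<close>, so by the
      gamma property at \<open>z n\<close> only finitely many indices of \<open>J\<close> belong to
      this family.\<close>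
    have fibre: "finite {k\<in>J. fst (p k) = n}" for n
    proof (rule finite_subset)
      show "{k\<in>J. fst (p k) = n} \<subseteq> {k\<in>J. z n \<notin> U k}"
        by (auto simp: U_def)
      show "finite {k\<in>J. z n \<notin> U k}" using z(2) by (intro J(2)) auto
    qed
    show "infinite N"
    proof
      assume "finite N"
      then have "finite (\<Union>n\<in>N. {k\<in>J. fst (p k) = n})" using fibre by (rule finite_UN_I)
      also have "(\<Union>n\<in>N. {k\<in>J. fst (p k) = n}) = J" by (auto simp: N_def)
      finally show False using J(1) by simp
    qed
  next
    fix x assume "x \<in> X"
    have "{n \<in> N. x \<notin> W n (snd (p (i n)))} \<subseteq> (\<lambda>k. fst (p k)) ` {k\<in>J. x \<notin> U k}"
    proof
      fix n assume n: "n \<in> {n \<in> N. x \<notin> W n (snd (p (i n)))}"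
      then have "x \<notin> U (i n)" using i[of n] by (auto simp: U_def)
      then show "n \<in> (\<lambda>k. fst (p k)) ` {k\<in>J. x \<notin> U k}"
        using i[of n] n by force
    qed
    then show "finite {n \<in> N. x \<notin> W n (snd (p (i n)))}"
      using J(2)[OF \<open>x \<in> X\<close>] by (meson finite_imageI finite_subset)
  qed
qed

text \<open>\<open>W n m\<close> intersects the sets \<open>A k m\<close> over all
  \<open>k \<le> n\<close>, so a choice made at \<open>n\<close> serves all smaller indices too.
  This fills the gaps of the infinite set \<open>N\<close>: index \<open>k\<close> uses the choice
  at some \<open>i k \<ge> k\<close> in \<open>N\<close>.\<close>

lemma borel_gamma_imp_bounded:
  fixes X :: "'a::t1_space set"
  assumes X: "borel_gamma X"
  shows "borel_bounded X"
  unfolding borel_bounded_def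
proof (intro allI impI)
  fix A :: "nat \<Rightarrow> nat \<Rightarrow> 'a set"
  assume A: "\<forall>n m. A n m \<in> sets borel" "\<forall>n. incseq (A n)" "\<forall>n. X \<subseteq> (\<Union>m. A n m)"
  define W where "W n m = (\<Inter>k\<in>{..n}. A k m)" for n m
  have "W n m \<in> sets borel" for n m
    unfolding W_def using A(1) by (intro sets.finite_INT) auto
  moreover have "\<exists>m. F \<subseteq> W n m" if F: "finite F" "F \<subseteq> X" for n F
  proof -
    have "\<forall>p. \<exists>m. fst p \<in> F \<longrightarrow> fst p \<in> A (snd p) m" using A(3) F(2) by blast
    then obtain m where m: "\<And>x k. x \<in> F \<Longrightarrow> x \<in> A k (m (x, k))" by (metis fst_conv snd_conv)
    define M where "M = Max (insert 0 (m ` (F \<times> {..n})))"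
    have "x \<in> A k M" if "x \<in> F" "k \<le> n" for x k
    proof -
      have "m (x, k) \<le> M" unfolding M_def using F(1) that by (intro Max_ge) auto
      then show ?thesis using A(2) m[OF that(1)] by (meson incseqD subsetD)
    qed
    then have "F \<subseteq> W n M" by (auto simp: W_def)
    then show ?thesis by blast
  qed
  ultimately obtain N and s :: "nat \<Rightarrow> nat"
    where N: "infinite N" "\<And>x. x \<in> X \<Longrightarrow> finite {n\<in>N. x \<notin> W n (s n)}"
    using borel_gamma_columns[OF X, of W] by metis
  obtain i where i: "\<And>k. k \<le> i k" "\<And>k. i k \<in> N"
    using N(1) unfolding infinite_nat_iff_unbounded_le by metis
  have "eventually (\<lambda>k. x \<in> A k (s (i k))) sequentially" if "x \<in> X" for x
  proof -
    from N(2)[OF that] obtain B where B: "\<And>n. n \<in> N \<Longrightarrow> x \<notin> W n (s n) \<Longrightarrow> n < B"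
      unfolding finite_nat_set_iff_bounded by blast
    have "x \<in> A k (s (i k))" if "k \<ge> B" for k
    proof -
      have "x \<in> W (i k) (s (i k))" using B[OF i(2)[of k]] i(1)[of k] that by fastforce
      then show ?thesis using i(1)[of k] by (auto simp: W_def)
    qed
    then show ?thesis unfolding eventually_sequentially by blast
  qed
  then show "\<exists>g. \<forall>x\<in>X. eventually (\<lambda>n. x \<in> A n (g n)) sequentially"
    by (intro exI[of _ "\<lambda>k. s (i k)"]) blast
qed

text \<open>Pairing gives each \<open>n\<close> its own infinite supply of families. A finite
  \<open>F\<close> is covered by one set per point, each from a different family of this supply, so
  finite lists \<open>s\<close> index an omega-cover in this sense.\<close>

lemma borel_gamma_imp_rothberger:
  fixes X :: "'a::t1_space set"
  assumes X: "borel_gamma X"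
  shows "borel_rothberger X"
  unfolding borel_rothberger_def
proof (intro allI impI)
  fix V :: "nat \<Rightarrow> nat \<Rightarrow> 'a set"
  assume V: "\<forall>n k. V n k \<in> sets borel" "\<forall>n. X \<subseteq> (\<Union>k. V n k)"
  define W where "W n s = (\<Union>l\<in>{..<length s}. V (prod_encode (n, l)) (s ! l))" for n s
  have "W n s \<in> sets borel" for n s
    unfolding W_def using V(1) by (intro sets.finite_UN) auto
  moreover have "\<exists>s. F \<subseteq> W n s" if F: "finite F" "F \<subseteq> X" for n F
  proof -
    obtain xs where xs: "set xs = F" using finite_list[OF F(1)] by blast
    have "\<forall>l. \<exists>k. l < length xs \<longrightarrow> xs ! l \<in> V (prod_encode (n, l)) k"
    proof
      fix l
      show "\<exists>k. l < length xs \<longrightarrow> xs ! l \<in> V (prod_encode (n, l)) k"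
      proof (cases "l < length xs")
        case True
        then have "xs ! l \<in> X" using xs F(2) by auto
        then show ?thesis using V(2) by blast
      qed simp
    qed
    then obtain k where k: "\<And>l. l < length xs \<Longrightarrow> xs ! l \<in> V (prod_encode (n, l)) (k l)" by metis
    have "F \<subseteq> W n (map k [0..<length xs])"
    proof
      fix x assume "x \<in> F"
      then obtain l where "l < length xs" "xs ! l = x" using xs by (metis in_set_conv_nth)
      then show "x \<in> W n (map k [0..<length xs])" using k[of l] by (auto simp: W_def)
    qed
    then show ?thesis by blast
  qed
  ultimately obtain N and s :: "nat \<Rightarrow> nat list"
    where N: "infinite N" "\<And>x. x \<in> X \<Longrightarrow> finite {n\<in>N. x \<notin> W n (s n)}"
    using borel_gamma_columns[OF X, of W] by metis
  \<comment> \<open>Positions beyond the list receive an unspecified index; extra sets only enlarge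
    the union.\<close>
  define k where "k q = (case prod_decode q of (n, l) \<Rightarrow> s n ! l)" for q
  have "x \<in> (\<Union>q. V q (k q))" if "x \<in> X" for x
  proof -
    have "infinite (N - {n\<in>N. x \<notin> W n (s n)})" using N(1) N(2)[OF that] by simp
    then have "N - {n\<in>N. x \<notin> W n (s n)} \<noteq> {}" by (rule infinite_imp_nonempty)
    then obtain n where "n \<in> N - {n\<in>N. x \<notin> W n (s n)}" by blast
    then obtain l where "l < length (s n)" "x \<in> V (prod_encode (n, l)) (s n ! l)"
      by (auto simp: W_def)
    then have "x \<in> V (prod_encode (n, l)) (k (prod_encode (n, l)))" by (simp add: k_def)
    then show ?thesis by blast
  qed
  then show "\<exists>k. X \<subseteq> (\<Union>n. V n (k n))" by blast
qed

lemma borel_bounded_Un: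
  assumes "borel_bounded X" "borel_bounded Y"
  shows "borel_bounded (X \<union> Y)"
  unfolding borel_bounded_def
proof (intro allI impI)
  fix A :: "nat \<Rightarrow> nat \<Rightarrow> 'a set"
  assume A: "\<forall>n m. A n m \<in> sets borel" "\<forall>n. incseq (A n)" "\<forall>n. X \<union> Y \<subseteq> (\<Union>m. A n m)"
  obtain g h where g: "\<forall>x\<in>X. eventually (\<lambda>n. x \<in> A n (g n)) sequentially"
    and h: "\<forall>x\<in>Y. eventually (\<lambda>n. x \<in> A n (h n)) sequentially"
    using A assms unfolding borel_bounded_def by (metis Un_subset_iff)
  have "eventually (\<lambda>n. x \<in> A n (max (g n) (h n))) sequentially" if "x \<in> X \<union> Y" for x
    using that
  proof
    assume "x \<in> X"
    with g have "eventually (\<lambda>n. x \<in> A n (g n)) sequentially" by blast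
    then show ?thesis by (rule eventually_mono) (use A(2) in \<open>meson incseqD max.cobounded1 subsetD\<close>)
  next
    assume "x \<in> Y"
    with h have "eventually (\<lambda>n. x \<in> A n (h n)) sequentially" by blast
    then show ?thesis by (rule eventually_mono) (use A(2) in \<open>meson incseqD max.cobounded2 subsetD\<close>)
  qed
  then show "\<exists>g. \<forall>x\<in>X \<union> Y. eventually (\<lambda>n. x \<in> A n (g n)) sequentially"
    by (intro exI[of _ "\<lambda>n. max (g n) (h n)"]) blast
qed

text \<open>The families of even index are spent on \<open>X\<close> and those of odd index on
  \<open>Y\<close>.\<close>

lemma borel_rothberger_Un:
  assumes "borel_rothberger X" "borel_rothberger Y"
  shows "borel_rothberger (X \<union> Y)"
  unfolding borel_rothberger_def
proof (intro allI impI)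
  fix V :: "nat \<Rightarrow> nat \<Rightarrow> 'a set"
  assume V: "\<forall>n k. V n k \<in> sets borel" "\<forall>n. X \<union> Y \<subseteq> (\<Union>k. V n k)"
  obtain k where k: "X \<subseteq> (\<Union>n. V (2 * n) (k n))"
    using assms(1)[unfolded borel_rothberger_def, rule_format, of "\<lambda>n. V (2 * n)"] V by auto
  obtain l where l: "Y \<subseteq> (\<Union>n. V (2 * n + 1) (l n))"
    using assms(2)[unfolded borel_rothberger_def, rule_format, of "\<lambda>n. V (2 * n + 1)"] V by auto
  define h where "h n = (if even n then k (n div 2) else l (n div 2))" for n
  have h: "h (2 * n) = k n" "h (2 * n + 1) = l n" for n
    by (simp_all add: h_def)
  have "X \<subseteq> (\<Union>n. V n (h n))" using k by (fastforce simp flip: h(1))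
  moreover have "Y \<subseteq> (\<Union>n. V n (h n))" using l by (fastforce simp flip: h(2))
  ultimately have "X \<union> Y \<subseteq> (\<Union>n. V n (h n))" by simp
  then show "\<exists>k. X \<union> Y \<subseteq> (\<Union>n. V n (k n))" by blast
qed

subsection \<open>Selection principles for subspaces\<close>

lemma borel_trace:
  assumes "B \<in> borel_sets_of (top_of_set X)"
  obtains A where "A \<in> sets borel" "B = A \<inter> X"
proof -
  have "B \<in> sigma_sets X {U. openin (top_of_set X) U}"
    using assms by (simp add: borel_sets_of_def)
  then have "\<exists>A. A \<in> sets borel \<and> B = A \<inter> X"
  proof induction
    case (Basic B)
    then obtain T where "open T" "B = X \<inter> T" by (auto simp: openin_open)
    then show ?case by (intro exI[of _ T]) (simp add: Int_commute)
  next
    case Empty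
    then show ?case by (intro exI[of _ "{}"]) simp
  next
    case (Compl B)
    then obtain A where A: "A \<in> sets borel" "B = A \<inter> X" by blast
    have "X - B = (- A) \<inter> X" using A(2) by blast
    moreover have "- A \<in> sets borel" using A(1) by (rule borel_comp)
    ultimately show ?case by blast
  next
    case (Union B)
    then obtain A where A: "\<And>n. A n \<in> sets borel" "\<And>n. B n = A n \<inter> X" by metis
    have "(\<Union>n. B n) = (\<Union>n. A n) \<inter> X" using A(2) by blast
    moreover have "(\<Union>n. A n) \<in> sets borel" using A(1) by blast
    ultimately show ?case by blast
  qed
  then show thesis using that by blast
qed

lemma countable_borel_enumeration:
  assumes "countable \<U>" "\<U> \<noteq> {}" "\<U> \<subseteq> borel_sets_of (top_of_set X)"
  shows "\<exists>A. (\<forall>n. A n \<in> sets borel) \<and> from_nat_into \<U> = (\<lambda>n. A n \<inter> X)"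
proof -
  have "\<exists>A. A \<in> sets borel \<and> from_nat_into \<U> n = A \<inter> X" for n
  proof -
    have "from_nat_into \<U> n \<in> borel_sets_of (top_of_set X)"
      using from_nat_into[OF assms(2)] assms(3) by (rule subsetD[rotated])
    then obtain A where "A \<in> sets borel" "from_nat_into \<U> n = A \<inter> X"
      by (rule borel_trace)
    then show ?thesis by blast
  qed
  then obtain A where A: "\<And>n. A n \<in> sets borel" "\<And>n. from_nat_into \<U> n = A n \<inter> X" by metis
  then have eq: "from_nat_into \<U> = (\<lambda>n. A n \<inter> X)" by (simp add: fun_eq_iff)
  then show ?thesis using A(1) eq by blast
qed

text \<open>Open covers may be uncountable; the Lindelof property reduces them to sequences, to
  which the Borel principles apply.\<close>

lemma open_cover_enumeration:
  fixes X :: "'a::second_countable_topology set"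
  assumes "\<U> \<in> open_covers (top_of_set X)" "X \<noteq> {}"
  obtains A :: "nat \<Rightarrow> 'a set" where "\<And>n. open (A n)" "\<And>n. A n \<inter> X \<in> \<U>" "X \<subseteq> (\<Union>n. A n)"
proof -
  define \<G> where "\<G> = {G. open G \<and> G \<inter> X \<in> \<U>}"
  obtain \<H> where \<H>: "\<H> \<subseteq> \<G>" "countable \<H>" "\<Union>\<H> = \<Union>\<G>"
    using Lindelof[of \<G>] by (auto simp: \<G>_def)
  have "X \<subseteq> \<Union>\<G>"
  proof
    fix x assume "x \<in> X"
    then obtain U where U: "x \<in> U" "U \<in> \<U>" using assms(1) by (auto simp: open_covers_def is_cover_def)
    then obtain G where "open G" "U = X \<inter> G" using assms(1) by (auto simp: open_covers_def openin_open)
    then show "x \<in> \<Union>\<G>" using U by (auto simp: \<G>_def Int_commute)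
  qed
  then have "\<H> \<noteq> {}" "X \<subseteq> \<Union>\<H>" using \<H>(3) assms(2) by auto
  then have ran: "range (from_nat_into \<H>) = \<H>" using \<H>(2) by (simp add: range_from_nat_into)
  show thesis
  proof (rule that)
    have "from_nat_into \<H> n \<in> \<G>" for n using ran \<H>(1) by blast
    then show "open (from_nat_into \<H> n)" "from_nat_into \<H> n \<inter> X \<in> \<U>" for n by (simp_all add: \<G>_def)
    show "X \<subseteq> (\<Union>n. from_nat_into \<H> n)" using \<open>X \<subseteq> \<Union>\<H>\<close> ran by simp
  qed
qed

text \<open>The range is infinite because a value taken infinitely often would contain every point
  of \<open>X\<close>, whereas all values are proper subsets.\<close>

lemma is_gamma_cover_range:
  fixes U :: "nat \<Rightarrow> 'a::topological_space set"
  assumes U: "\<And>n. U n \<subseteq> X" "\<And>n. U n \<noteq> X"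
    and ev: "\<And>x. x \<in> X \<Longrightarrow> eventually (\<lambda>n. x \<in> U n) sequentially"
  shows "is_gamma_cover (top_of_set X) (range U)"
proof -
  have "X = \<Union>(range U)"
  proof
    show "X \<subseteq> \<Union>(range U)"
      using ev unfolding eventually_sequentially by blast
  qed (use U(1) in blast)
  moreover have "\<not> (\<exists>W\<in>range U. X \<subseteq> W)"
    using U by blast
  ultimately have 1: "is_cover (top_of_set X) (range U)" by (simp add: is_cover_def)
  have 2: "finite {n. x \<notin> U n}" if "x \<in> X" for x
    using ev[OF that] by (simp add: cofinite_eq_sequentially[symmetric] eventually_cofinite)
  have 3: "infinite (range U)"
  proof
    assume "finite (range U)"
    then obtain n0 where n0: "infinite {n. U n = U n0}"
      using pigeonhole_infinite[of UNIV U] by auto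
    have "x \<in> U n0" if "x \<in> X" for x
    proof (rule ccontr)
      assume "x \<notin> U n0"
      then have "{n. U n = U n0} \<subseteq> {n. x \<notin> U n}" by auto
      then show False using n0 2[OF that] finite_subset by blast
    qed
    then show False using U by blast
  qed
  have "finite {W \<in> range U. x \<notin> W}" if "x \<in> X" for x
  proof (rule finite_subset)
    show "{W \<in> range U. x \<notin> W} \<subseteq> U ` {n. x \<notin> U n}" by blast
    show "finite (U ` {n. x \<notin> U n})" using 2[OF that] by simp
  qed
  with 1 3 show ?thesis by (simp add: is_gamma_cover_def)
qed

lemma borel_gamma_sel_binom:
  assumes "borel_gamma X"
  shows "sel_binom borel_omega_covers borel_gamma_covers (top_of_set X)"
  unfolding sel_binom_def
proof
  fix \<U> assume \<U>: "\<U> \<in> borel_omega_covers (top_of_set X)"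
  then have om: "is_cover (top_of_set X) \<U>" "\<And>F. finite F \<Longrightarrow> F \<subseteq> X \<Longrightarrow> \<exists>U\<in>\<U>. F \<subseteq> U"
    and bor: "countable \<U>" "\<U> \<subseteq> borel_sets_of (top_of_set X)"
    by (auto simp: borel_omega_covers_def is_omega_cover_def)
  have "\<U> \<noteq> {}" using om(2)[of "{}"] by auto
  obtain A where A: "\<And>n. A n \<in> sets borel" "from_nat_into \<U> = (\<lambda>n. A n \<inter> X)"
    using countable_borel_enumeration[OF bor(1) \<open>\<U> \<noteq> {}\<close> bor(2)] by blast
  have ran: "range (\<lambda>n. A n \<inter> X) = \<U>"
    using range_from_nat_into[OF \<open>\<U> \<noteq> {}\<close> bor(1)] A(2) by simp
  have "\<exists>n. F \<subseteq> A n" if F: "finite F" "F \<subseteq> X" for F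
    using om(2)[OF F] unfolding ran[symmetric] by auto
  then obtain j :: "nat \<Rightarrow> nat" where j: "\<And>x. x \<in> X \<Longrightarrow> eventually (\<lambda>m. x \<in> A (j m)) sequentially"
    using assms A(1) unfolding borel_gamma_def by meson
  have mem: "A (j m) \<inter> X \<in> \<U>" for m using ran by blast
  have "is_gamma_cover (top_of_set X) (range (\<lambda>m. A (j m) \<inter> X))"
  proof (rule is_gamma_cover_range)
    show "A (j m) \<inter> X \<noteq> X" for m
      using mem[of m] om(1) by (auto simp: is_cover_def)
    show "eventually (\<lambda>m. x \<in> A (j m) \<inter> X) sequentially" if "x \<in> X" for x
      using j[OF that] by (rule eventually_mono) (use that in simp)
  qed auto
  moreover have sub: "range (\<lambda>m. A (j m) \<inter> X) \<subseteq> \<U>" using mem by blast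
  ultimately have "range (\<lambda>m. A (j m) \<inter> X) \<in> borel_gamma_covers (top_of_set X)"
    using bor(2) by (auto simp: borel_gamma_covers_def)
  then show "\<exists>\<V>\<in>borel_gamma_covers (top_of_set X). \<V> \<subseteq> \<U>" using sub by blast
qed

text \<open>Membership patterns of points in a \<open>\<tau>\<close>-cover are linearly quasi-ordered modulo finite sets, so
  of the two pseudo-intersections obtained for \<open>X\<close> and \<open>Y\<close> one works for all points of \<open>X \<union> Y\<close>.\<close>

lemma tau_pseudo_intersection_Un:
  fixes V :: "nat \<Rightarrow> 'a::topological_space set"
  assumes X: "borel_gamma X" and Y: "borel_gamma Y" and V: "\<And>n. V n \<in> sets borel"
    and inf: "\<And>x. x \<in> X \<union> Y \<Longrightarrow> infinite {n. x \<in> V n}"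
    and lin: "\<And>x y. x \<in> X \<union> Y \<Longrightarrow> y \<in> X \<union> Y \<Longrightarrow> finite {n. x \<in> V n \<and> y \<notin> V n} \<or> finite {n. y \<in> V n \<and> x \<notin> V n}"
  obtains J where "infinite J" "\<And>x. x \<in> X \<union> Y \<Longrightarrow> finite {n\<in>J. x \<notin> V n}"
proof -
  define Q where "Q x y \<longleftrightarrow> finite {n. x \<in> V n \<and> y \<notin> V n}" for x y
  have Qtrans: "Q x z" if "Q x y" "Q y z" for x y z
  proof -
    have "{n. x \<in> V n \<and> z \<notin> V n} \<subseteq> {n. x \<in> V n \<and> y \<notin> V n} \<union> {n. y \<in> V n \<and> z \<notin> V n}" by blast
    then show ?thesis using that unfolding Q_def by (meson finite_UnI finite_subset)
  qed
  have Qrefl: "Q x x" for x by (simp add: Q_def)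
  have ps: "finite {n\<in>J. y \<notin> V n}" if "finite {n\<in>J. x \<notin> V n}" "Q x y" for J x y
  proof (rule finite_subset)
    show "{n\<in>J. y \<notin> V n} \<subseteq> {n\<in>J. x \<notin> V n} \<union> {n. x \<in> V n \<and> y \<notin> V n}" by blast
    show "finite ({n\<in>J. x \<notin> V n} \<union> {n. x \<in> V n \<and> y \<notin> V n})" using that by (simp add: Q_def)
  qed
  have omega: "infinite {n. F \<subseteq> V n}" if "finite F" "F \<subseteq> X \<union> Y" for F
  proof (cases "F = {}")
    case True
    then show ?thesis by (simp add: infinite_UNIV_nat)
  next
    case False
    \<comment> \<open>A finite set has a point with the smallest membership pattern modulo finite
      sets; almost all sets containing this point contain all of \<open>F\<close>.\<close>
    have "\<exists>x\<in>F. \<forall>y\<in>F. Q x y"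
      using \<open>finite F\<close> False \<open>F \<subseteq> X \<union> Y\<close>
    proof (induction rule: finite_ne_induct)
      case (singleton x)
      then show ?case using Qrefl by blast
    next
      case (insert a F)
      then obtain x where x: "x \<in> F" "\<forall>y\<in>F. Q x y" by blast
      have "Q x a \<or> Q a x" using lin[of x a] insert.prems x(1) by (auto simp: Q_def)
      then show ?case using x Qtrans Qrefl by blast
    qed
    then obtain x where x: "x \<in> F" "\<And>y. y \<in> F \<Longrightarrow> Q x y" by blast
    have "finite (\<Union>y\<in>F. {n. x \<in> V n \<and> y \<notin> V n})"
      using \<open>finite F\<close> x(2) by (auto simp: Q_def)
    then have "infinite ({n. x \<in> V n} - (\<Union>y\<in>F. {n. x \<in> V n \<and> y \<notin> V n}))"
      using inf[of x] x(1) \<open>F \<subseteq> X \<union> Y\<close> by auto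
    moreover have "{n. x \<in> V n} - (\<Union>y\<in>F. {n. x \<in> V n \<and> y \<notin> V n}) \<subseteq> {n. F \<subseteq> V n}" by blast
    ultimately show ?thesis using infinite_super by blast
  qed
  obtain J where J: "infinite J" "\<And>x. x \<in> X \<Longrightarrow> finite {n\<in>J. x \<notin> V n}"
  proof (rule borel_gamma_infinite[OF X V])
    show "infinite {n. F \<subseteq> V n}" if "finite F" "F \<subseteq> X" for F
      using that by (intro omega) auto
  qed (rule that)
  obtain K where K: "infinite K" "\<And>x. x \<in> Y \<Longrightarrow> finite {n\<in>K. x \<notin> V n}"
  proof (rule borel_gamma_infinite[OF Y V])
    show "infinite {n. F \<subseteq> V n}" if "finite F" "F \<subseteq> Y" for F
      using that by (intro omega) auto
  qed (rule that)
  show thesis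
  \<comment> \<open>If the pattern of some \<open>x\<close> in \<open>X\<close> lies below those of
    all \<open>y\<close> in \<open>Y\<close>, then \<open>J\<close> serves \<open>Y\<close> as well;
    otherwise every pattern from \<open>X\<close> lies above one from \<open>Y\<close>, and
    \<open>K\<close> serves both.\<close>
  proof (cases "\<exists>x\<in>X. \<forall>y\<in>Y. \<not> Q y x")
    case True
    then obtain x where x: "x \<in> X" "\<And>y. y \<in> Y \<Longrightarrow> \<not> Q y x" by blast
    have "Q x y" if "y \<in> Y" for y
      using lin[of x y] x(1) x(2)[OF that] that by (auto simp: Q_def)
    then show thesis using that[OF J(1)] J(2) x(1) ps by (metis UnE)
  next
    case False
    then show thesis using that[OF K(1)] K(2) ps by (metis UnE)
  qed
qed

text \<open>Each tau-cover is thinned out to a sequence that eventually contains every point.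
  Choosing one member from each sequence is then a matter of bounding, for each point, the index
  from which it stays inside.\<close>

lemma sel_S1_borel_tau_gamma_Un:
  fixes X0 X1 :: "'a::t1_space set"
  assumes X0: "borel_gamma X0" and X1: "borel_gamma X1" and X: "X = X0 \<union> X1" "X \<noteq> {}"
  shows "sel_S1 borel_tau_covers borel_gamma_covers (top_of_set X)"
  unfolding sel_S1_def
proof (intro allI impI)
  fix \<U> :: "nat \<Rightarrow> 'a set set"
  assume \<U>: "\<forall>n. \<U> n \<in> borel_tau_covers (top_of_set X)"
  have ex: "\<exists>A :: nat \<Rightarrow> 'a set. (\<forall>k. A k \<in> sets borel \<and> A k \<inter> X \<in> \<U> n) \<and> (\<forall>x\<in>X. finite {k. x \<notin> A k})" for n
  proof -
    have bor: "countable (\<U> n)" "\<U> n \<subseteq> borel_sets_of (top_of_set X)"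
      and inf: "\<And>x. x \<in> X \<Longrightarrow> infinite {U \<in> \<U> n. x \<in> U}"
      and lin: "\<And>x y. x \<in> X \<Longrightarrow> y \<in> X \<Longrightarrow> finite {U\<in>\<U> n. \<not> (x \<in> U \<longrightarrow> y \<in> U)} \<or> finite {U\<in>\<U> n. \<not> (y \<in> U \<longrightarrow> x \<in> U)}"
      using spec[OF \<U>, of n] by (auto simp: borel_tau_covers_def is_tau_cover_def)
    have infU: "infinite (\<U> n)"
    proof
      assume "finite (\<U> n)"
      moreover obtain x where "x \<in> X" using X(2) by blast
      ultimately show False using inf[of x] by simp
    qed
    then have "\<U> n \<noteq> {}" by auto
    obtain V where V: "\<And>k. V k \<in> sets borel" "from_nat_into (\<U> n) = (\<lambda>k. V k \<inter> X)"
      using countable_borel_enumeration[OF bor(1) \<open>\<U> n \<noteq> {}\<close> bor(2)] by blast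
    have ran: "range (\<lambda>k. V k \<inter> X) = \<U> n"
      using range_from_nat_into[OF \<open>\<U> n \<noteq> {}\<close> bor(1)] V(2) by simp
    \<comment> \<open>With an injective enumeration, finiteness of a set of members and of the
      corresponding set of indices are the same.\<close>
    have inj: "inj (\<lambda>k. V k \<inter> X)"
      using bij_betw_from_nat_into[OF bor(1) infU] unfolding V(2) by (rule bij_betw_imp_inj_on)
    have fin: "finite {k. P (V k \<inter> X)} \<longleftrightarrow> finite {U \<in> \<U> n. P U}" for P
    proof -
      have "{U \<in> \<U> n. P U} = (\<lambda>k. V k \<inter> X) ` {k. P (V k \<inter> X)}"
        by (auto simp flip: ran)
      then show ?thesis using inj by (simp add: finite_image_iff inj_on_def)
    qed
    obtain J where J: "infinite J" "\<And>x. x \<in> X0 \<union> X1 \<Longrightarrow> finite {k\<in>J. x \<notin> V k}"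
    proof (rule tau_pseudo_intersection_Un[OF X0 X1 V(1)])
      show "infinite {k. x \<in> V k}" if "x \<in> X0 \<union> X1" for x
        using inf[of x] fin[of "\<lambda>U. x \<in> U"] that X(1) by simp
      show "finite {k. x \<in> V k \<and> y \<notin> V k} \<or> finite {k. y \<in> V k \<and> x \<notin> V k}"
        if "x \<in> X0 \<union> X1" "y \<in> X0 \<union> X1" for x y
      proof -
        have "x \<in> X" "y \<in> X" using that X(1) by simp_all
        then show ?thesis
          using lin[of x y] fin[of "\<lambda>U. \<not> (x \<in> U \<longrightarrow> y \<in> U)"] fin[of "\<lambda>U. \<not> (y \<in> U \<longrightarrow> x \<in> U)"] by simp
      qed
    qed (rule that)
    define e where "e = enumerate J"
    have e: "strict_mono e" "range e = J"
      using J(1) by (simp_all add: e_def strict_mono_enumerate range_enumerate)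
    have "finite {k. x \<notin> V (e k)}" if "x \<in> X" for x
    proof -
      have "finite {k\<in>J. x \<notin> V k}" using J(2) that X(1) by simp
      then have "finite (e -` {k\<in>J. x \<notin> V k})"
        using e(1) by (intro finite_vimageI) (simp_all add: strict_mono_imp_inj_on)
      moreover have "e -` {k\<in>J. x \<notin> V k} = {k. x \<notin> V (e k)}" using e(2) by blast
      ultimately show ?thesis by simp
    qed
    moreover have "V (e k) \<inter> X \<in> \<U> n" for k using ran by blast
    ultimately show ?thesis using V(1) by (intro exI[of _ "\<lambda>k. V (e k)"]) simp
  qed
  then have "\<exists>A :: nat \<Rightarrow> nat \<Rightarrow> 'a set. \<forall>n. (\<forall>k. A n k \<in> sets borel \<and> A n k \<inter> X \<in> \<U> n) \<and> (\<forall>x\<in>X. finite {k. x \<notin> A n k})"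
    by (intro choice allI)
  then obtain A :: "nat \<Rightarrow> nat \<Rightarrow> 'a set" where A: "\<And>n k. A n k \<in> sets borel" "\<And>n k. A n k \<inter> X \<in> \<U> n"
    "\<And>n x. x \<in> X \<Longrightarrow> finite {k. x \<notin> A n k}"
    by blast
  \<comment> \<open>\<open>B n m\<close> holds the points whose settling time in the sequence
    \<open>A n\<close> is at most \<open>m\<close>, an increasing Borel cover.\<close>
  define B where "B n m = (\<Inter>k\<in>{m..}. A n k)" for n m
  have "borel_bounded X"
    unfolding X(1) using X0 X1 by (intro borel_bounded_Un borel_gamma_imp_bounded)
  moreover have "B n m \<in> sets borel" for n m
    unfolding B_def using A(1) by (intro sets.countable_INT'') auto
  moreover have "incseq (B n)" for n
    unfolding B_def by (intro monoI INF_superset_mono) auto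
  moreover have "X \<subseteq> (\<Union>m. B n m)" for n
  proof
    fix x assume "x \<in> X"
    then obtain m where "\<And>k. x \<notin> A n k \<Longrightarrow> k < m"
      using A(3)[of x n] unfolding finite_nat_set_iff_bounded by blast
    then have "x \<in> B n m" unfolding B_def using leD by blast
    then show "x \<in> (\<Union>m. B n m)" by blast
  qed
  ultimately obtain g where g: "\<And>x. x \<in> X \<Longrightarrow> eventually (\<lambda>n. x \<in> B n (g n)) sequentially"
    unfolding borel_bounded_def by meson
  have "is_gamma_cover (top_of_set X) (range (\<lambda>n. A n (g n) \<inter> X))"
  proof (rule is_gamma_cover_range)
    show "A n (g n) \<inter> X \<noteq> X" for n
      using A(2)[of n "g n"] spec[OF \<U>, of n] by (auto simp: borel_tau_covers_def is_tau_cover_def is_cover_def)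
    show "eventually (\<lambda>n. x \<in> A n (g n) \<inter> X) sequentially" if "x \<in> X" for x
      using g[OF that] by (rule eventually_mono) (use that in \<open>auto simp: B_def\<close>)
  qed auto
  moreover have "range (\<lambda>n. A n (g n) \<inter> X) \<subseteq> borel_sets_of (top_of_set X)"
    using A(2) \<U> by (auto simp: borel_tau_covers_def)
  ultimately have "range (\<lambda>n. A n (g n) \<inter> X) \<in> borel_gamma_covers (top_of_set X)"
    by (simp add: borel_gamma_covers_def)
  then show "\<exists>U. (\<forall>n. U n \<in> \<U> n) \<and> {U n |n. True} \<in> borel_gamma_covers (top_of_set X)"
    using A(2) by (intro exI[of _ "\<lambda>n. A n (g n) \<inter> X"]) (simp add: full_SetCompr_eq)
qed

lemma is_cover_range:
  assumes "\<And>n. U n \<in> \<U> n" "\<And>n. is_cover (top_of_set X) (\<U> n)" "X \<subseteq> (\<Union>n. U n)"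
  shows "is_cover (top_of_set X) {U n |n. True}"
proof -
  have "U n \<subseteq> X" "\<not> X \<subseteq> U n" for n
    using assms(1)[of n] assms(2)[of n] by (auto simp: is_cover_def)
  then show ?thesis
    using assms(3) by (auto simp: is_cover_def full_SetCompr_eq)
qed

lemma borel_rothberger_sel_S1:
  fixes X :: "'a::topological_space set"
  assumes R: "borel_rothberger X" and "X \<noteq> {}"
  shows "sel_S1 borel_covers borel_covers (top_of_set X)"
  unfolding sel_S1_def
proof (intro allI impI)
  fix \<U> :: "nat \<Rightarrow> 'a set set"
  assume \<U>: "\<forall>n. \<U> n \<in> borel_covers (top_of_set X)"
  have cov: "is_cover (top_of_set X) (\<U> n)" "countable (\<U> n)" "\<U> n \<subseteq> borel_sets_of (top_of_set X)" for n
    using \<U> by (auto simp: borel_covers_def)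
  have "\<exists>A :: nat \<Rightarrow> 'a set. (\<forall>k. A k \<in> sets borel) \<and> range (\<lambda>k. A k \<inter> X) = \<U> n" for n
  proof -
    have ne: "\<U> n \<noteq> {}" using cov(1)[of n] \<open>X \<noteq> {}\<close> by (auto simp: is_cover_def)
    obtain A where A: "\<And>k. A k \<in> sets borel" "from_nat_into (\<U> n) = (\<lambda>k. A k \<inter> X)"
      using countable_borel_enumeration[OF cov(2) ne cov(3)] by blast
    have "range (\<lambda>k. A k \<inter> X) = \<U> n"
      using range_from_nat_into[OF ne cov(2)] A(2) by simp
    then show ?thesis using A(1) by blast
  qed
  then obtain A :: "nat \<Rightarrow> nat \<Rightarrow> 'a set" where A: "\<And>n k. A n k \<in> sets borel" "\<And>n. range (\<lambda>k. A n k \<inter> X) = \<U> n" by metis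
  have "X \<subseteq> (\<Union>k. A n k)" for n
    using cov(1)[of n] unfolding is_cover_def A(2)[symmetric] by auto
  then obtain k where k: "X \<subseteq> (\<Union>n. A n (k n))"
    using R A(1) unfolding borel_rothberger_def by meson
  have mem: "A n (k n) \<inter> X \<in> \<U> n" for n using A(2)[of n] by blast
  have "is_cover (top_of_set X) {A n (k n) \<inter> X |n. True}"
    by (rule is_cover_range[of _ \<U>]) (use mem cov(1) k in auto)
  moreover have "{A n (k n) \<inter> X |n. True} \<subseteq> borel_sets_of (top_of_set X)"
    using mem cov(3) by blast
  ultimately show "\<exists>U. (\<forall>n. U n \<in> \<U> n) \<and> {U n |n. True} \<in> borel_covers (top_of_set X)"
    using mem by (intro exI[of _ "\<lambda>n. A n (k n) \<inter> X"]) (simp add: borel_covers_def full_SetCompr_eq)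
qed

lemma borel_rothberger_sel_S1_open:
  fixes X :: "'a::second_countable_topology set"
  assumes R: "borel_rothberger X" and "X \<noteq> {}"
  shows "sel_S1 open_covers open_covers (top_of_set X)"
  unfolding sel_S1_def
proof (intro allI impI)
  fix \<U> :: "nat \<Rightarrow> 'a set set"
  assume \<U>: "\<forall>n. \<U> n \<in> open_covers (top_of_set X)"
  have "\<exists>A :: nat \<Rightarrow> 'a set. (\<forall>k. open (A k) \<and> A k \<inter> X \<in> \<U> n) \<and> X \<subseteq> (\<Union>k. A k)" for n
    using open_cover_enumeration[OF spec[OF \<U>] \<open>X \<noteq> {}\<close>, of n] by metis
  then obtain A :: "nat \<Rightarrow> nat \<Rightarrow> 'a set" where A: "\<And>n k. open (A n k)" "\<And>n k. A n k \<inter> X \<in> \<U> n"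
    "\<And>n. X \<subseteq> (\<Union>k. A n k)" by metis
  then obtain k where k: "X \<subseteq> (\<Union>n. A n (k n))"
    using R borel_open unfolding borel_rothberger_def by meson
  have "is_cover (top_of_set X) {A n (k n) \<inter> X |n. True}"
    by (rule is_cover_range[of _ \<U>]) (use A(2) \<U> k in \<open>auto simp: open_covers_def\<close>)
  moreover have "openin (top_of_set X) (A n (k n) \<inter> X)" for n
    using A(2) \<U> by (auto simp: open_covers_def)
  ultimately show "\<exists>U. (\<forall>n. U n \<in> \<U> n) \<and> {U n |n. True} \<in> open_covers (top_of_set X)"
    using A(2) by (intro exI[of _ "\<lambda>n. A n (k n) \<inter> X"]) (auto simp: open_covers_def)
qed

text \<open>Partial unions of an enumerated cover increase, so boundedness chooses how long they
  must be. The absence of finite subcovers makes all chosen unions proper subsets of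
  \<open>X\<close>, as \<open>is_gamma_cover_range\<close> requires.\<close>

lemma borel_bounded_sel_Ufin:
  fixes X :: "'a::second_countable_topology set"
  assumes B: "borel_bounded X" and "X \<noteq> {}"
  shows "sel_Ufin open_covers open_gamma_covers (top_of_set X)"
  unfolding sel_Ufin_def
proof (intro allI impI)
  fix \<U> :: "nat \<Rightarrow> 'a set set"
  assume \<U>: "\<forall>n. \<U> n \<in> open_covers (top_of_set X) \<and>
    \<not> (\<exists>\<F>. finite \<F> \<and> \<F> \<subseteq> \<U> n \<and> \<Union>\<F> = topspace (top_of_set X))"
  then have \<U>': "\<U> n \<in> open_covers (top_of_set X)" for n by simp
  have "\<exists>A :: nat \<Rightarrow> 'a set. (\<forall>k. open (A k) \<and> A k \<inter> X \<in> \<U> n) \<and> X \<subseteq> (\<Union>k. A k)" for n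
    using open_cover_enumeration[OF \<U>' \<open>X \<noteq> {}\<close>, of n] by metis
  then obtain A :: "nat \<Rightarrow> nat \<Rightarrow> 'a set" where A: "\<And>n k. open (A n k)" "\<And>n k. A n k \<inter> X \<in> \<U> n"
    "\<And>n. X \<subseteq> (\<Union>k. A n k)" by metis
  define C where "C n m = (\<Union>k\<in>{..m}. A n k)" for n m
  have "C n m \<in> sets borel" for n m
    unfolding C_def using A(1) by (intro borel_open open_UN) auto
  moreover have "incseq (C n)" for n
    unfolding C_def by (intro monoI UN_mono) auto
  moreover have "X \<subseteq> (\<Union>m. C n m)" for n
    using A(3)[of n] unfolding C_def by blast
  ultimately obtain g where g: "\<And>x. x \<in> X \<Longrightarrow> eventually (\<lambda>n. x \<in> C n (g n)) sequentially"
    using B unfolding borel_bounded_def by meson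
  define \<F> where "\<F> n = (\<lambda>k. A n k \<inter> X) ` {..g n}" for n
  have \<F>: "finite (\<F> n)" "\<F> n \<subseteq> \<U> n" "\<Union>(\<F> n) = C n (g n) \<inter> X" for n
    using A(2) by (auto simp: \<F>_def C_def)
  have "is_gamma_cover (top_of_set X) (range (\<lambda>n. \<Union>(\<F> n)))"
  proof (rule is_gamma_cover_range)
    show "\<Union>(\<F> n) \<subseteq> X" for n using \<F>(3) by simp
    show "\<Union>(\<F> n) \<noteq> X" for n using \<U> \<F>(1,2)[of n] by auto
    show "eventually (\<lambda>n. x \<in> \<Union>(\<F> n)) sequentially" if "x \<in> X" for x
      unfolding \<F>(3) using g[OF that] by (rule eventually_mono) (use that in simp)
  qed
  moreover have "openin (top_of_set X) (\<Union>(\<F> n))" for n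
    using \<F>(2)[of n] \<U>'[of n] by (intro openin_Union) (auto simp: open_covers_def)
  ultimately have "{\<Union>(\<F> n) |n. True} \<in> open_gamma_covers (top_of_set X)"
    by (auto simp: open_gamma_covers_def full_SetCompr_eq)
  then show "\<exists>\<F>. (\<forall>n. finite (\<F> n) \<and> \<F> n \<subseteq> \<U> n) \<and> {\<Union>(\<F> n) |n. True} \<in> open_gamma_covers (top_of_set X)"
    using \<F>(1,2) by blast
qed

subsection \<open>Failure of the Menger property in the square\<close>

text \<open>For infinitely differing \<open>x\<close> and \<open>y\<close>, the map sending
  \<open>n\<close> to the least \<open>m\<close> with \<open>n < diff_count m x y\<close> is the
  element of the Baire space attached to the pair. That \<open>diff_count (g n) x y \<le> n\<close>
  means that this element exceeds \<open>g\<close> at \<open>n\<close>.\<close>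

definition diff_count :: "nat \<Rightarrow> (nat \<Rightarrow> bool) \<Rightarrow> (nat \<Rightarrow> bool) \<Rightarrow> nat" where
  "diff_count m x y = card {i. i \<le> m \<and> x i \<noteq> y i}"

lemma diff_count_mono: "m \<le> m' \<Longrightarrow> diff_count m x y \<le> diff_count m' x y"
  unfolding diff_count_def by (rule card_mono) auto

lemma diff_count_agree:
  assumes "agree (Suc m) x x'" "agree (Suc m) y y'"
  shows "diff_count m x y = diff_count m x' y'"
proof -
  have "{i. i \<le> m \<and> x i \<noteq> y i} = {i. i \<le> m \<and> x' i \<noteq> y' i}"
    using assms by (auto simp: agree_def less_Suc_eq_le)
  then show ?thesis by (simp add: diff_count_def)
qed

lemma diff_count_unbounded:
  assumes "infinite {i. x i \<noteq> y i}"
  shows "eventually (\<lambda>m. n < diff_count m x y) sequentially"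
proof -
  obtain B where B: "finite B" "card B = Suc n" "B \<subseteq> {i. x i \<noteq> y i}"
    using infinite_arbitrarily_large[OF assms] by blast
  have "n < diff_count m x y" if "m \<ge> Max (insert 0 B)" for m
  proof -
    have "B \<subseteq> {i. i \<le> m \<and> x i \<noteq> y i}"
    proof
      fix i assume "i \<in> B"
      then have "i \<le> Max (insert 0 B)" using B(1) by simp
      then show "i \<in> {i. i \<le> m \<and> x i \<noteq> y i}" using that B(3) \<open>i \<in> B\<close> by auto
    qed
    then have "card B \<le> diff_count m x y"
      unfolding diff_count_def by (intro card_mono) auto
    then show ?thesis using B(2) by simp
  qed
  then show ?thesis unfolding eventually_sequentially by blast
qed

definition sparse_position :: "(nat \<Rightarrow> bool) set \<Rightarrow> (nat \<Rightarrow> bool) set \<Rightarrow> bool" where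
  "sparse_position P Q \<longleftrightarrow> (\<forall>x\<in>P. \<forall>y\<in>Q. infinite {i. x i \<noteq> y i}) \<and>
     (\<forall>g. \<exists>x\<in>P. \<exists>y\<in>Q. \<forall>n. diff_count (g n) x y \<le> n)"

lemma cantor_embed_near_False:
  assumes "r \<in> cantor_embed False ` P \<union> cantor_embed True ` Q" "\<bar>cantor_embed False x - r\<bar> < 1/2 * (1/3) ^ m"
  shows "\<exists>x'\<in>P. r = cantor_embed False x' \<and> agree (Suc m) x x'"
  using assms(1)
proof (elim UnE imageE)
  fix x' assume "r = cantor_embed False x'" "x' \<in> P"
  then show ?thesis using cantor_embed_close[of False x False x' m] assms(2) by blast
next
  fix y assume "r = cantor_embed True y"
  then show ?thesis using cantor_embed_close[of False x True y m] assms(2) by blast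
qed

lemma cantor_embed_near_True:
  assumes "r \<in> cantor_embed False ` P \<union> cantor_embed True ` Q" "\<bar>cantor_embed True y - r\<bar> < 1/2 * (1/3) ^ m"
  shows "\<exists>y'\<in>Q. r = cantor_embed True y' \<and> agree (Suc m) y y'"
  using assms(1)
proof (elim UnE imageE)
  fix x assume "r = cantor_embed False x"
  then show ?thesis using cantor_embed_close[of True y False x m] assms(2) by blast
next
  fix y' assume "r = cantor_embed True y'" "y' \<in> Q"
  then show ?thesis using cantor_embed_close[of True y True y' m] assms(2) by blast
qed

text \<open>A set in \<open>\<W> n\<close> carries a threshold \<open>m\<close> by which every pair
  from the two copies inside it has more than \<open>n\<close> differences. Finite selections have
  bounded thresholds \<open>g n\<close>, and a pair with at most \<open>n\<close> differences up to
  \<open>g n\<close>, for all \<open>n\<close>, lies together in none of the selected sets.\<close>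

lemma not_sel_Sfin_omega:
  assumes PQ: "sparse_position P Q" and X: "X = cantor_embed False ` P \<union> cantor_embed True ` Q"
  shows "\<not> sel_Sfin open_omega_covers open_omega_covers (top_of_set X)"
proof
  assume sel: "sel_Sfin open_omega_covers open_omega_covers (top_of_set X)"
  have inf: "\<And>x y. x \<in> P \<Longrightarrow> y \<in> Q \<Longrightarrow> infinite {i. x i \<noteq> y i}"
    and sparse: "\<And>g. \<exists>x\<in>P. \<exists>y\<in>Q. \<forall>n. diff_count (g n) x y \<le> n"
    using PQ by (auto simp: sparse_position_def)
  define ok where "ok n W m \<longleftrightarrow> (\<forall>x\<in>P. \<forall>y\<in>Q. cantor_embed False x \<in> W \<longrightarrow> cantor_embed True y \<in> W \<longrightarrow> n < diff_count m x y)"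
    for n W m
  define \<W> where "\<W> n = {W. openin (top_of_set X) W \<and> (\<exists>m. ok n W m)}" for n
  have omega: "\<exists>W\<in>\<W> n. F \<subseteq> W" if F: "finite F" "F \<subseteq> X" for n F
  proof -
    have inj: "inj (cantor_embed b)" for b by (rule injI) (simp add: cantor_embed_inject)
    have "finite (cantor_embed False -` F)" "finite (cantor_embed True -` F)"
      using F(1) inj by (simp_all add: finite_vimageI)
    then have "eventually (\<lambda>m. \<forall>x\<in>cantor_embed False -` F \<inter> P. \<forall>y\<in>cantor_embed True -` F \<inter> Q. n < diff_count m x y) sequentially"
      using inf by (intro eventually_ball_finite ballI diff_count_unbounded) auto
    then obtain m where m: "\<And>x y. x \<in> P \<Longrightarrow> cantor_embed False x \<in> F \<Longrightarrow> y \<in> Q \<Longrightarrow> cantor_embed True y \<in> F \<Longrightarrow> n < diff_count m x y"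
      unfolding eventually_sequentially by blast
    \<comment> \<open>Within this radius points lie in the same copy and agree up to
      \<open>m\<close>, so \<open>diff_count m\<close> is unchanged.\<close>
    define e :: real where "e = 1/2 * (1/3) ^ m"
    define W where "W = X \<inter> (\<Union>s\<in>F. ball s e)"
    have "openin (top_of_set X) W"
      unfolding W_def by (intro openin_open_Int open_UN ballI open_ball)
    moreover have "ok n W m"
      unfolding ok_def
    proof (intro ballI impI)
      fix x y assume xy: "x \<in> P" "y \<in> Q" "cantor_embed False x \<in> W" "cantor_embed True y \<in> W"
      obtain r where r: "r \<in> F" "\<bar>cantor_embed False x - r\<bar> < e"
        using xy(3) by (auto simp: W_def dist_real_def abs_minus_commute)
      obtain s where s: "s \<in> F" "\<bar>cantor_embed True y - s\<bar> < e"
        using xy(4) by (auto simp: W_def dist_real_def abs_minus_commute)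
      obtain x' where x': "x' \<in> P" "r = cantor_embed False x'" "agree (Suc m) x x'"
        using cantor_embed_near_False[of r P Q x m] r F(2) unfolding X e_def by blast
      obtain y' where y': "y' \<in> Q" "s = cantor_embed True y'" "agree (Suc m) y y'"
        using cantor_embed_near_True[of s P Q y m] s F(2) unfolding X e_def by blast
      show "n < diff_count m x y"
        using m[of x' y'] x' y' r(1) s(1) diff_count_agree by simp
    qed
    moreover have "F \<subseteq> W"
      using F(2) by (auto simp: W_def e_def intro!: bexI)
    ultimately show ?thesis by (auto simp: \<W>_def)
  qed
  have cov: "\<W> n \<in> open_omega_covers (top_of_set X)" for n
  proof -
    have "X \<subseteq> \<Union>(\<W> n)"
      using omega[of "{x}" n for x] by blast
    moreover have "\<Union>(\<W> n) \<subseteq> X"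
      using openin_imp_subset by (fastforce simp: \<W>_def)
    moreover have "\<not> X \<subseteq> W" if "W \<in> \<W> n" for W
    proof
      assume "X \<subseteq> W"
      from that obtain m where m: "ok n W m" by (auto simp: \<W>_def)
      \<comment> \<open>A constant function yields a pair without any difference up to
        \<open>m\<close>.\<close>
      obtain x y where xy: "x \<in> P" "y \<in> Q" "\<And>k. diff_count m x y \<le> k"
        using sparse[of "\<lambda>_. m"] by blast
      then have "cantor_embed False x \<in> W" "cantor_embed True y \<in> W" using \<open>X \<subseteq> W\<close> X by auto
      then have "n < diff_count m x y"
        using m xy(1,2) unfolding ok_def by blast
      then show False using xy(3)[of n] by simp
    qed
    ultimately have "is_cover (top_of_set X) (\<W> n)" by (auto simp: is_cover_def)
    moreover have "\<forall>W\<in>\<W> n. openin (top_of_set X) W" by (simp add: \<W>_def)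
    ultimately show ?thesis
      using omega unfolding open_omega_covers_def is_omega_cover_def by simp
  qed
  have "\<exists>\<F>. (\<forall>n. finite (\<F> n) \<and> \<F> n \<subseteq> \<W> n) \<and> (\<Union>n. \<F> n) \<in> open_omega_covers (top_of_set X)"
    by (rule sel[unfolded sel_Sfin_def, rule_format]) (rule cov)
  then obtain \<F> where \<F>: "\<And>n. finite (\<F> n)" "\<And>n. \<F> n \<subseteq> \<W> n"
    "(\<Union>n. \<F> n) \<in> open_omega_covers (top_of_set X)"
    by blast
  have "\<forall>n W. \<exists>m. W \<in> \<W> n \<longrightarrow> ok n W m" by (auto simp: \<W>_def)
  then obtain m where m: "\<And>n W. W \<in> \<W> n \<Longrightarrow> ok n W (m n W)" by metis
  \<comment> \<open>\<open>insert 0\<close> provides for an empty selection.\<close>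
  define g where "g n = Max (insert 0 (m n ` \<F> n))" for n
  obtain x y where xy: "x \<in> P" "y \<in> Q" "\<And>n. diff_count (g n) x y \<le> n"
    using sparse[of g] by blast
  have "\<forall>F. finite F \<and> F \<subseteq> X \<longrightarrow> (\<exists>W\<in>(\<Union>n. \<F> n). F \<subseteq> W)"
    using \<F>(3) unfolding open_omega_covers_def is_omega_cover_def by simp
  moreover have "finite {cantor_embed False x, cantor_embed True y} \<and> {cantor_embed False x, cantor_embed True y} \<subseteq> X"
    using xy X by auto
  ultimately have "\<exists>W\<in>(\<Union>n. \<F> n). {cantor_embed False x, cantor_embed True y} \<subseteq> W" by blast
  then obtain n W where W: "W \<in> \<F> n" "cantor_embed False x \<in> W" "cantor_embed True y \<in> W" by blast
  then have "n < diff_count (m n W) x y"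
    using m[of W n] \<F>(2) xy(1,2) unfolding ok_def by blast
  also have "\<dots> \<le> diff_count (g n) x y"
    unfolding g_def using W(1) \<F>(1) by (intro diff_count_mono Max_ge) auto
  finally show False using xy(3)[of n] by simp
qed

text \<open>Each \<open>V n m\<close> contains everything outside the product of the two copies, and
  of the product the pairs with more than \<open>n\<close> differences up to \<open>m\<close>. It is
  open since the count depends on finitely many coordinates, and it grows with \<open>m\<close>, so
  finite selections reduce to one bound \<open>g n\<close>, which a sparse pair defeats.\<close>

lemma not_sel_Sfin_square:
  assumes PQ: "sparse_position P Q" and X: "X = cantor_embed False ` P \<union> cantor_embed True ` Q"
  shows "\<not> sel_Sfin open_covers open_covers (prod_topology (top_of_set X) (top_of_set X))"
proof
  have top: "prod_topology (top_of_set X) (top_of_set X) = top_of_set (X \<times> X)"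
    by (simp add: prod_topology_subtopology_eu)
  assume "sel_Sfin open_covers open_covers (prod_topology (top_of_set X) (top_of_set X))"
  then have sel: "sel_Sfin open_covers open_covers (top_of_set (X \<times> X))"
    unfolding top .
  have inf: "\<And>x y. x \<in> P \<Longrightarrow> y \<in> Q \<Longrightarrow> infinite {i. x i \<noteq> y i}"
    and sparse: "\<And>g. \<exists>x\<in>P. \<exists>y\<in>Q. \<forall>n. diff_count (g n) x y \<le> n"
    using PQ by (auto simp: sparse_position_def)
  define V where "V n m = X \<times> X - {(cantor_embed False x, cantor_embed True y) | x y. x \<in> P \<and> y \<in> Q \<and> diff_count m x y \<le> n}"
    for n m
  have Viff: "(cantor_embed False x, cantor_embed True y) \<in> V n m \<longleftrightarrow> n < diff_count m x y" if "x \<in> P" "y \<in> Q" for x y n m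
    using that X by (auto simp: V_def cantor_embed_inject)
  have "openin (top_of_set (X \<times> X)) (V n m)" for n m
    unfolding openin_euclidean_subtopology_iff
  proof (intro conjI ballI)
    show "V n m \<subseteq> X \<times> X" by (auto simp: V_def)
    fix p assume p: "p \<in> V n m"
    obtain r s where rs: "p = (r, s)" "r \<in> X" "s \<in> X" using p by (auto simp: V_def)
    define e :: real where "e = 1/2 * (1/3) ^ m"
    have "q \<in> V n m" if q: "q \<in> X \<times> X" "dist q p < e" for q
    proof (rule ccontr)
      assume "q \<notin> V n m"
      then obtain x y where xy: "q = (cantor_embed False x, cantor_embed True y)" "x \<in> P" "y \<in> Q" "diff_count m x y \<le> n"
        using q(1) unfolding V_def by blast
      have "\<bar>cantor_embed False x - r\<bar> < e" "\<bar>cantor_embed True y - s\<bar> < e"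
        using q(2) dist_fst_le[of q p] dist_snd_le[of q p] xy(1) rs(1) by (auto simp: dist_real_def)
      then obtain x' y' where "x' \<in> P" "r = cantor_embed False x'" "agree (Suc m) x x'"
        "y' \<in> Q" "s = cantor_embed True y'" "agree (Suc m) y y'"
        using cantor_embed_near_False[of r P Q x m] cantor_embed_near_True[of s P Q y m] rs(2,3) X unfolding e_def by metis
      then show False
        using p rs(1) Viff[of x' y' n m] diff_count_agree[of m x x' y y'] xy(4) by simp
    qed
    moreover have "e > 0" by (simp add: e_def)
    ultimately show "\<exists>e>0. \<forall>q\<in>X \<times> X. dist q p < e \<longrightarrow> q \<in> V n m" by blast
  qed
  moreover have "X \<times> X = \<Union>(range (V n))" for n
  proof (rule subset_antisym)
    show "\<Union>(range (V n)) \<subseteq> X \<times> X" by (auto simp: V_def)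
    show "X \<times> X \<subseteq> \<Union>(range (V n))"
    proof
      fix p assume p: "p \<in> X \<times> X"
      show "p \<in> (\<Union>m. V n m)"
      proof (cases "\<exists>x\<in>P. \<exists>y\<in>Q. p = (cantor_embed False x, cantor_embed True y)")
        case True
        then obtain x y where xy: "x \<in> P" "y \<in> Q" "p = (cantor_embed False x, cantor_embed True y)" by blast
        obtain m where "n < diff_count m x y"
          using diff_count_unbounded[OF inf[OF xy(1,2)]] unfolding eventually_sequentially by blast
        then show ?thesis using Viff xy by blast
      next
        case False
        then have "p \<in> V n 0" using p unfolding V_def by blast
        then show ?thesis by blast
      qed
    qed
  qed
  moreover have "\<not> X \<times> X \<subseteq> V n m" for n m
  proof
    assume sub: "X \<times> X \<subseteq> V n m"
    obtain x y where xy: "x \<in> P" "y \<in> Q" "\<And>k. diff_count m x y \<le> k"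
      using sparse[of "\<lambda>_. m"] by blast
    have "(cantor_embed False x, cantor_embed True y) \<in> X \<times> X" using xy X by blast
    then have "n < diff_count m x y" using sub Viff xy by blast
    then show False using xy(3)[of n] by simp
  qed
  ultimately have cov: "range (V n) \<in> open_covers (top_of_set (X \<times> X))" for n
    unfolding open_covers_def is_cover_def topspace_euclidean_subtopology by blast
  have "\<exists>\<F>. (\<forall>n. finite (\<F> n) \<and> \<F> n \<subseteq> range (V n)) \<and> (\<Union>n. \<F> n) \<in> open_covers (top_of_set (X \<times> X))"
    by (rule sel[unfolded sel_Sfin_def, rule_format]) (rule cov)
  then obtain \<F> where \<F>: "\<And>n. finite (\<F> n)" "\<And>n. \<F> n \<subseteq> range (V n)"
    "(\<Union>n. \<F> n) \<in> open_covers (top_of_set (X \<times> X))"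
    by blast
  have "\<exists>M. finite M \<and> \<F> n = V n ` M" for n
    using finite_subset_image[OF \<F>(1,2)] by blast
  then obtain M where M: "\<And>n. finite (M n)" "\<And>n. \<F> n = V n ` M n" by metis
  define g where "g n = Max (insert 0 (M n))" for n
  obtain x y where xy: "x \<in> P" "y \<in> Q" "\<And>n. diff_count (g n) x y \<le> n"
    using sparse[of g] by blast
  have "X \<times> X = \<Union>(\<Union>n. \<F> n)"
    using \<F>(3) unfolding open_covers_def is_cover_def by simp
  moreover have "(cantor_embed False x, cantor_embed True y) \<in> X \<times> X" using xy X by blast
  ultimately have "(cantor_embed False x, cantor_embed True y) \<in> \<Union>(\<Union>n. \<F> n)" by (rule subst)
  then obtain n m where "m \<in> M n" "(cantor_embed False x, cantor_embed True y) \<in> V n m"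
    using M(2) by auto
  then have "n < diff_count m x y" "m \<le> g n"
    using Viff xy(1,2) M(1) by (auto simp: g_def)
  then have "n < diff_count (g n) x y"
    using diff_count_mono[of m "g n" x y] by simp
  then show False using xy(3)[of n] by simp
qed

theorem theorem4p2:
  assumes "continuum_hypothesis"
  shows "\<exists>X0 X1 X :: real set.
    sel_binom borel_omega_covers borel_gamma_covers (top_of_set X0) \<and>
    sel_binom borel_omega_covers borel_gamma_covers (top_of_set X1) \<and>
    X = X0 \<union> X1 \<and>
    sel_S1 borel_tau_covers borel_gamma_covers (top_of_set X) \<and>
    sel_S1 borel_covers borel_covers (top_of_set X) \<and>
    sel_Ufin open_covers open_gamma_covers (top_of_set X) \<and>
    sel_S1 open_covers open_covers (top_of_set X) \<and>
    \<not> sel_Sfin open_omega_covers open_omega_covers (top_of_set X) \<and>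
    \<not> sel_Sfin open_covers open_covers (prod_topology (top_of_set X) (top_of_set X))"
proof -
  obtain P :: "bool \<Rightarrow> (nat \<Rightarrow> bool) set" where P:
    "(\<forall>b U. (\<forall>n. U n \<in> sets borel) \<longrightarrow> (\<forall>F. finite F \<and> F \<subseteq> P b \<longrightarrow> (\<exists>n. cantor_embed b ` F \<subseteq> U n)) \<longrightarrow>
      (\<exists>j :: nat \<Rightarrow> nat. \<forall>x\<in>P b. eventually (\<lambda>m. cantor_embed b x \<in> U (j m)) sequentially)) \<and>
    (\<forall>x\<in>P False. \<forall>y\<in>P True. infinite {i. x i \<noteq> y i}) \<and>
    (\<forall>g. \<exists>x\<in>P False. \<exists>y\<in>P True. \<forall>n. card {i. i \<le> g n \<and> x i \<noteq> y i} \<le> n)"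
    by (rule exE[OF gamma_pair_construction[OF assms]])
  note gam = conjunct1[OF P] and inf = conjunct1[OF conjunct2[OF P]] and sparse = conjunct2[OF conjunct2[OF P]]
  define Z where "Z b = cantor_embed b ` P b" for b
  define X where "X = Z False \<union> Z True"
  have Z: "borel_gamma (Z b)" for b
    unfolding borel_gamma_def
  proof (intro allI impI)
    fix U :: "nat \<Rightarrow> real set"
    assume U: "\<forall>n. U n \<in> sets borel" "\<forall>F. finite F \<and> F \<subseteq> Z b \<longrightarrow> (\<exists>n. F \<subseteq> U n)"
    have "\<exists>j :: nat \<Rightarrow> nat. \<forall>x\<in>P b. eventually (\<lambda>m. cantor_embed b x \<in> U (j m)) sequentially"
    proof (intro gam[rule_format])
      show "U n \<in> sets borel" for n using U(1) by simp
      show "\<exists>n. cantor_embed b ` F \<subseteq> U n" if "finite F \<and> F \<subseteq> P b" for F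
        using U(2)[rule_format, of "cantor_embed b ` F"] that by (auto simp: Z_def)
    qed
    then show "\<exists>j :: nat \<Rightarrow> nat. \<forall>x\<in>Z b. eventually (\<lambda>m. x \<in> U (j m)) sequentially"
      by (simp add: Z_def)
  qed
  have PQ: "sparse_position (P False) (P True)"
    using inf sparse by (simp add: sparse_position_def diff_count_def)
  have X: "X = cantor_embed False ` P False \<union> cantor_embed True ` P True"
    by (simp add: X_def Z_def)
  have "X \<noteq> {}"
    using spec[OF sparse, of id] X by auto
  have "borel_bounded X" "borel_rothberger X"
    unfolding X_def using Z
    by (simp_all add: borel_bounded_Un borel_gamma_imp_bounded borel_rothberger_Un borel_gamma_imp_rothberger)
  then show ?thesis
    using Z \<open>X \<noteq> {}\<close> PQ X
    by (intro exI[of _ "Z False"] exI[of _ "Z True"] exI[of _ X] conjI X_def borel_gamma_sel_binom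
        sel_S1_borel_tau_gamma_Un[OF Z Z X_def] borel_rothberger_sel_S1 borel_rothberger_sel_S1_open
        borel_bounded_sel_Ufin not_sel_Sfin_omega not_sel_Sfin_square)
qed

end
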